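(* Let $g=g(t,x)$ be a non-negative solution to the self-similar equation $$\partial_t g=-\tfrac14\,\partial_x(xg)+\mathcal{Q}_0(g,g),\qquad g(0,\cdot)=g_0,$$ satisfying the normalisation $\int_{\mathbb{R}}g(t,x)\,dx=1$, $\int_{\mathbb{R}}x\,g(t,x)\,dx=0$, $\int_{\mathbb{R}}x^2g(t,x)\,dx=1$ for all $t\ge0$. Then, for $0\le k<3$ and for all $t\ge0$, $$|||\widehat g(t,\cdot)-\widehat{H}|||_k\le \exp(-\sigma_k t)\,|||\widehat g_0-\widehat{H}|||_k,\qquad \sigma_k:=1-\tfrac14k-2^{1-k}.$$ In particular, $g(t)$ converges exponentially to $H$ in the $k$-Fourier norm $|||\cdot|||_k$ for any $2<k<3$. More generally, for $p\ge1$, $\frac1p<k<3+\frac1p$, and for all $t\ge0$, $$|||\widehat g(t,\cdot)-\widehat{H}|||_{k,p}\le \exp(-\sigma_k(p)t)\,|||\widehat g_0-\widehat{H}|||_{k,p},\qquad \sigma_k(p):=1-\tfrac14k+\tfrac1{4p}-2^{1+\frac1p-k}.$$ In particular, $g(t)$ converges exponentially to $H$ in the Fourier norm $|||\cdot|||_{k,p}$ for any $(k,p)$ such that $\sigma_k(p)>0$.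
   Context: Collision operator: $\mathcal{Q}_0(f,g)(x)=\int_{\mathbb{R}}f(x+\frac y2)g(x-\frac y2)\,dy-\frac12f(x)\int_{\mathbb{R}}g(y)\,dy-\frac12g(x)\int_{\mathbb{R}}f(y)\,dy$; in weak form $\int\mathcal{Q}_0(f,g)\phi\,dx=\iint f(x)g(y)\big(\phi(\frac{x+y}2)-\frac12\phi(x)-\frac12\phi(y)\big)dx\,dy$. Solutions are understood in the weak sense: $\mathcal{M}_2(\mathbb{R})$ is the set of real Borel measures $\mu$ on $\mathbb{R}$ with $\int(1+|x|)^2|\mu|(dx)<\infty$, and a family of non-negative measures $\mu:[0,\infty)\to\mathcal{M}_2(\mathbb{R})$ (here $\mu(t,dx)=g(t,x)\,dx$) is a weak solution of $\partial_tg=-\frac14\partial_x(xg)+\mathcal{Q}_0(g,g)$ if for all $\phi\in\mathcal{C}^1_b(\mathbb{R})$, $$\frac{d}{dt}\int\phi\,\mu(t,dx)=\frac14\int x\phi'(x)\mu(t,dx)+\iint\Big(\phi\big(\tfrac{x+y}2\big)-\tfrac12\phi(x)-\tfrac12\phi(y)\Big)\mu(t,dx)\mu(t,dy).$$ $H(x)=\frac{2}{\pi(1+x^2)^2}$ is the steady solution with unit mass, zero momentum and unit energy. Fourier transform: $\widehat f(\xi)=\int_{\mathbb{R}}f(x)e^{-ix\xi}dx$; $\widehat H(\xi)=(1+|\xi|)e^{-|\xi|}$. Fourier norms: $|||\psi|||_k=\sup_{\xi\ne0}\frac{|\psi(\xi)|}{|\xi|^k}$ and, for $1\le p<\infty$,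 $|||\psi|||_{k,p}=\Big(\int_{\mathbb{R}}\frac{|\psi(\xi)|^p}{|\xi|^{kp}}\,d\xi\Big)^{1/p}$.
   Formalization: Both "in particular" convergence claims are stated for data whose initial norm |||ĝ_0−Ĥ|||_k (resp. |||ĝ_0−Ĥ|||_{k,p}) is finite; for g_0 with infinite moments of every order above 2 these norms are infinite for all t and convergence fails. *)

theory Defs
  imports "HOL-Analysis.Analysis"
begin

(* The type "real measure" only contains non-negative measures, so this is the non-negative
   cone of the space M_2(R) of real Borel measures with finite weighted total variation;
   weak solutions take their values in this cone. *)
definition M2_nonneg :: "real measure set" where
  "M2_nonneg = {\<mu>. sets \<mu> = sets borel \<and> (\<integral>\<^sup>+x. ennreal ((1 + \<bar>x\<bar>)\<^sup>2) \<partial>\<mu>) < \<infinity>}"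

(* Bounded C^1 functions with bounded derivative. *)
definition C1b :: "(real \<Rightarrow> real) set" where
  "C1b = {\<phi>. (\<forall>x. \<phi> differentiable (at x)) \<and> continuous_on UNIV (deriv \<phi>) \<and>
              bounded (range \<phi>) \<and> bounded (range (deriv \<phi>))}"

(* The collision operator Q_0(mu, mu), tested against phi. *)
definition collision_weak :: "real measure \<Rightarrow> (real \<Rightarrow> real) \<Rightarrow> real" where
  "collision_weak \<mu> \<phi> =
     (\<integral>(x, y). \<phi> ((x + y) / 2) - \<phi> x / 2 - \<phi> y / 2 \<partial>(\<mu> \<Otimes>\<^sub>M \<mu>))"

(* Weak solutions of d/dt g = -1/4 d/dx (x g) + Q_0(g, g) on the time interval [0, infinity);
   the time derivative is one-sided at t = 0. *)
definition weak_solution :: "(real \<Rightarrow> real measure) \<Rightarrow> bool" where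
  "weak_solution \<mu> \<longleftrightarrow>
     (\<forall>t\<ge>0. \<mu> t \<in> M2_nonneg) \<and>
     (\<forall>\<phi>\<in>C1b. \<forall>t\<ge>0.
        ((\<lambda>s. \<integral>x. \<phi> x \<partial>\<mu> s) has_real_derivative
           1/4 * (\<integral>x. x * deriv \<phi> x \<partial>\<mu> t) + collision_weak (\<mu> t) \<phi>) (at t within {0..}))"

definition H :: "real \<Rightarrow> real" where
  "H x = 2 / (pi * (1 + x\<^sup>2)\<^sup>2)"

definition fourier :: "(real \<Rightarrow> real) \<Rightarrow> real \<Rightarrow> complex" where
  "fourier f \<xi> = (\<integral>x. complex_of_real (f x) * exp (- (\<i> * complex_of_real (x * \<xi>))) \<partial>lborel)"

(* Both Fourier norms take values in [0, infinity]. *)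
definition fnorm :: "real \<Rightarrow> (real \<Rightarrow> complex) \<Rightarrow> ennreal" where
  "fnorm k \<psi> = (SUP \<xi>\<in>-{0}. ennreal (cmod (\<psi> \<xi>) / \<bar>\<xi>\<bar> powr k))"

(* The power a^r on [0, infinity] for an exponent r > 0. *)
definition ennpowr :: "ennreal \<Rightarrow> real \<Rightarrow> ennreal" where
  "ennpowr a r = (if a = \<infinity> then \<infinity> else ennreal (enn2real a powr r))"

definition fnorm_p :: "real \<Rightarrow> real \<Rightarrow> (real \<Rightarrow> complex) \<Rightarrow> ennreal" where
  "fnorm_p k p \<psi> =
     ennpowr (\<integral>\<^sup>+\<xi>. ennreal (cmod (\<psi> \<xi>) powr p / \<bar>\<xi>\<bar> powr (k * p)) \<partial>lborel) (1 / p)"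

definition rate :: "real \<Rightarrow> real" where
  "rate k = 1 - k / 4 - 2 powr (1 - k)"

definition rate_p :: "real \<Rightarrow> real \<Rightarrow> real" where
  "rate_p k p = 1 - k / 4 + 1 / (4 * p) - 2 powr (1 + 1 / p - k)"

(* The constant C is real, so this forces N t to be finite for all t >= 0. *)
definition decays_exponentially :: "(real \<Rightarrow> ennreal) \<Rightarrow> bool" where
  "decays_exponentially N \<longleftrightarrow>
     (\<exists>C r :: real. 0 < r \<and> (\<forall>t\<ge>0. N t \<le> ennreal (C * exp (- r * t))))"

end

theory Submission
  imports Defs "HOL-Probability.Characteristic_Functions" "HOL-Probability.Sinc_Integral"
begin

text \<open>
  In Fourier variables the equation reads
  \<open>\<partial>\<^sub>t G = \<xi>/4 \<partial>\<^sub>\<xi> G + G(\<xi>/2)\<^sup>2 - G(\<xi>)\<close>, and \<open>(1 + \<bar>\<xi>\<bar>) exp (-\<bar>\<xi>\<bar>)\<close>, the transform of \<open>H\<close>,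
  is a stationary solution. As both functions are bounded by \<open>1\<close>, the difference \<open>\<psi>\<close> satisfies
  \<open>\<bar>v\<^sub>n'\<bar> \<le> 2 \<bar>v\<^sub>n\<^sub>+\<^sub>1\<bar>\<close> for \<open>v\<^sub>n(s) = exp s \<psi>(s, exp (-s/4) 2^(-n) \<zeta>)\<close>. Iterating this
  bounds \<open>\<bar>\<psi>(t, \<xi>)\<bar>\<close> by \<open>exp (-t) (\<Sum>j. (2t)^j/j! \<bar>\<psi>(0, exp (t/4) 2^(-j) \<xi>)\<bar>)\<close>. Each term is a
  dilation of the initial datum, whose homogeneous norms scale explicitly; summing the norms
  (Jensen's inequality in the \<open>L\<^sup>p\<close> case) gives the exponential rates, without any a priori
  finiteness of the norms at positive times.
\<close>

subsection \<open>Growth estimates and derivatives along curves\<close>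

text \<open>Induction on \<open>m\<close>: the bound for level \<open>n + 1\<close> is inserted into
  the derivative estimate at level \<open>n\<close> and integrated in time, which turns
  \<open>(c * t) ^ j / fact j\<close> into the next such term. Hence \<open>n\<close> and
  \<open>t\<close> vary in the induction. As \<open>v'\<close> is controlled only through its norm,
  the mean value inequality takes the place of integration. The uniform bound \<open>K\<close> is
  spent on the last level, where it produces the truncation error.\<close>

lemma iterated_growth_bound:
  fixes v v' :: "nat \<Rightarrow> real \<Rightarrow> 'a::real_normed_vector"
  assumes deriv: "\<And>n s. 0 \<le> s \<Longrightarrow> (v n has_vector_derivative v' n s) (at s within {0..})"
    and v': "\<And>n s. 0 \<le> s \<Longrightarrow> norm (v' n s) \<le> c * norm (v (Suc n) s)"
    and K: "\<And>n s. 0 \<le> s \<Longrightarrow> s \<le> T \<Longrightarrow> norm (v n s) \<le> K" and c: "0 \<le> c"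
  shows "0 \<le> t \<Longrightarrow> t \<le> T \<Longrightarrow>
    norm (v n t) \<le> (\<Sum>j<m. (c * t) ^ j / fact j * norm (v (n + j) 0)) + K * ((c * t) ^ m / fact m)"
proof (induction m arbitrary: n t)
  case 0
  then show ?case using K by simp
next
  case (Suc m)
  \<comment> \<open>\<open>h'\<close> is \<open>c\<close> times the induction hypothesis for level
    \<open>Suc n\<close>, and \<open>h\<close> is its primitive vanishing at 0.\<close>
  define h where "h t = (\<Sum>j<m. (c * t) ^ Suc j / fact (Suc j) * norm (v (Suc n + j) 0)) + K * ((c * t) ^ Suc m / fact (Suc m))" for t
  define h' where "h' t = c * ((\<Sum>j<m. (c * t) ^ j / fact j * norm (v (Suc n + j) 0)) + K * ((c * t) ^ m / fact m))" for t
  have pow: "((\<lambda>t. (c * t) ^ Suc j / fact (Suc j)) has_real_derivative c * ((c * t) ^ j / fact j)) (at t)" for j t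
  proof -
    have "((\<lambda>t. (c * t) ^ Suc j / fact (Suc j)) has_real_derivative real (Suc j) * (c * (c * t) ^ j) / fact (Suc j)) (at t)"
      by (auto intro!: derivative_eq_intros simp del: power_Suc fact_Suc of_nat_Suc)
    also have "real (Suc j) * (c * (c * t) ^ j) / fact (Suc j) = c * ((c * t) ^ j / fact j)"
      by (simp only: fact_Suc of_nat_mult mult_divide_mult_cancel_left_if of_nat_eq_0_iff nat.simps if_False times_divide_eq_right)
    finally show ?thesis .
  qed
  have h: "(h has_vector_derivative h' s) (at s)" for s
    unfolding has_real_derivative_iff_has_vector_derivative[symmetric] h_def h'_def
    by (rule derivative_eq_intros pow refl)+ (simp add: sum_distrib_left algebra_simps)
  have step: "norm (v n t - v n 0) \<le> h t - h 0"
  proof (cases "t = 0")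
    case False
    show ?thesis
    proof (rule differentiable_bound_general)
      show "0 < t" using False Suc.prems by simp
      show "continuous_on {0..t} (v n)"
        unfolding continuous_on_eq_continuous_within
      proof
        fix s assume "s \<in> {0..t}"
        then have "continuous (at s within {0..}) (v n)"
          by (intro has_vector_derivative_continuous[OF deriv]) simp
        then show "continuous (at s within {0..t}) (v n)"
          by (rule continuous_within_subset) auto
      qed
      show "continuous_on {0..t} h"
        by (intro continuous_at_imp_continuous_on ballI has_vector_derivative_continuous[OF h])
      show "(h has_vector_derivative h' s) (at s)" for s by (rule h)
      show "(v n has_vector_derivative v' n s) (at s)" if "0 < s" "s < t" for s
      proof -
        have "(v n has_vector_derivative v' n s) (at s within {0<..})"
          using that by (intro has_vector_derivative_within_subset[OF deriv[of s n]]) auto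
        then show ?thesis using that by (simp add: at_within_open[of s "{0<..}"])
      qed
      show "norm (v' n s) \<le> h' s" if "0 < s" "s < t" for s
      proof -
        have "norm (v' n s) \<le> c * norm (v (Suc n) s)" using that by (intro v') simp
        also have "\<dots> \<le> h' s"
          unfolding h'_def by (rule mult_left_mono[OF Suc.IH c]) (use that Suc.prems in auto)
        finally show ?thesis .
      qed
    qed
  qed simp
  have "h 0 = 0" by (simp add: h_def)
  with step have "norm (v n t) \<le> norm (v n 0) + h t"
    using norm_triangle_sub[of "v n t" "v n 0"] by linarith
  also have "\<dots> = (\<Sum>j<Suc m. (c * t) ^ j / fact j * norm (v (n + j) 0)) + K * ((c * t) ^ Suc m / fact (Suc m))"
    unfolding sum.lessThan_Suc_shift h_def
    by (simp only: power_0 fact_0 div_by_1 mult_1 add_0_right add_Suc add_Suc_right add.assoc)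
  finally show ?case .
qed

text \<open>The difference quotient carries the sign of \<open>y - x\<close>, the definition of the
  derivative only its modulus. Passing to norms removes the discrepancy.\<close>

lemma has_vector_derivative_iff_quotient:
  fixes f :: "real \<Rightarrow> 'a::real_normed_vector"
  shows "(f has_vector_derivative D) (at x within S) \<longleftrightarrow>
    ((\<lambda>y. (f y - f x) /\<^sub>R (y - x)) \<longlongrightarrow> D) (at x within S)"
proof -
  have "(f has_vector_derivative D) (at x within S) \<longleftrightarrow>
    ((\<lambda>y. (f y - (f x + (y - x) *\<^sub>R D)) /\<^sub>R \<bar>y - x\<bar>) \<longlongrightarrow> 0) (at x within S)"
    by (simp add: has_vector_derivative_def has_derivative_within bounded_linear_scaleR_left divide_inverse_commute)
  also have "\<dots> \<longleftrightarrow> ((\<lambda>y. norm ((f y - (f x + (y - x) *\<^sub>R D)) /\<^sub>R \<bar>y - x\<bar>)) \<longlongrightarrow> 0) (at x within S)"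
    by (rule tendsto_norm_zero_iff[symmetric])
  also have "\<dots> \<longleftrightarrow> ((\<lambda>y. norm ((f y - f x) /\<^sub>R (y - x) - D)) \<longlongrightarrow> 0) (at x within S)"
  proof (rule filterlim_cong[OF refl refl])
    have "norm ((f y - (f x + (y - x) *\<^sub>R D)) /\<^sub>R \<bar>y - x\<bar>) = norm ((f y - f x) /\<^sub>R (y - x) - D)" if "y \<noteq> x" for y
    proof -
      have "D = ((y - x) *\<^sub>R D) /\<^sub>R (y - x)" using that by simp
      then have "(f y - f x) /\<^sub>R (y - x) - D = ((f y - f x) - (y - x) *\<^sub>R D) /\<^sub>R (y - x)"
        by (metis scaleR_diff_right)
      then show ?thesis by (simp add: diff_diff_add)
    qed
    then show "\<forall>\<^sub>F y in at x within S. norm ((f y - (f x + (y - x) *\<^sub>R D)) /\<^sub>R \<bar>y - x\<bar>) = norm ((f y - f x) /\<^sub>R (y - x) - D)"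
      by (auto simp: eventually_at_filter)
  qed
  also have "\<dots> \<longleftrightarrow> ((\<lambda>y. (f y - f x) /\<^sub>R (y - x)) \<longlongrightarrow> D) (at x within S)"
    by (simp only: tendsto_norm_zero_iff LIM_zero_iff)
  finally show ?thesis .
qed

text \<open>A chain rule that assumes no joint differentiability. The second-order estimate in space
  is uniform in time, so \<open>D s \<xi>\<close> is a uniform limit of difference quotients of
  \<open>F\<close> and inherits continuity in \<open>s\<close>; the same estimate makes the error of
  following the curve quadratic in \<open>c s - c t\<close>, hence negligible against
  \<open>s - t\<close>.\<close>

lemma has_vector_derivative_along_curve:
  fixes F D :: "real \<Rightarrow> real \<Rightarrow> 'a::real_normed_vector"
  assumes taylor: "\<And>s \<xi> \<eta>. 0 \<le> s \<Longrightarrow> norm (F s \<eta> - F s \<xi> - (\<eta> - \<xi>) *\<^sub>R D s \<xi>) \<le> C * (\<eta> - \<xi>)\<^sup>2"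
    and F: "\<And>\<xi>. ((\<lambda>s. F s \<xi>) has_vector_derivative F' \<xi>) (at t within {0..})"
    and c: "(c has_real_derivative c') (at t within {0..})"
    and t: "0 \<le> t"
  shows "((\<lambda>s. F s (c s)) has_vector_derivative F' (c t) + c' *\<^sub>R D t (c t)) (at t within {0..})"
proof -
  let ?A = "at t within {0..}"
  have C: "0 \<le> C"
    using order_trans[OF norm_ge_zero taylor[of 0 1 0]] by simp
  have ev: "\<forall>\<^sub>F s in ?A. 0 \<le> s" by (simp add: eventually_at_filter)
  have cont: "((\<lambda>s. F s \<xi>) \<longlongrightarrow> F t \<xi>) ?A" for \<xi>
    using has_vector_derivative_continuous[OF F] by (simp add: continuous_within)
  have D: "((\<lambda>s. D s \<xi>) \<longlongrightarrow> D t \<xi>) ?A" for \<xi>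
  proof (rule tendstoI)
    fix e :: real assume e: "0 < e"
    \<comment> \<open>The Taylor errors at times \<open>s\<close> and \<open>t\<close> are at most
      \<open>C * d\<close> each. This \<open>d\<close> keeps their sum below \<open>e / 2\<close>,
      also when \<open>C = 0\<close>, and leaves \<open>e / 2\<close> for the change of the quotient
      in time.\<close>
    define d where "d = e / (4 * C + 4)"
    have d: "0 < d" "2 * C * d < e / 2" using e C by (auto simp: d_def field_simps)
    let ?q = "\<lambda>s. (F s (\<xi> + d) - F s \<xi>) /\<^sub>R d"
    have q: "norm (?q s - D s \<xi>) \<le> C * d" if "0 \<le> s" for s
    proof -
      have "norm (?q s - D s \<xi>) = norm ((F s (\<xi> + d) - F s \<xi> - d *\<^sub>R D s \<xi>) /\<^sub>R d)"
        using d by (simp add: algebra_simps)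
      also have "\<dots> = norm (F s (\<xi> + d) - F s \<xi> - d *\<^sub>R D s \<xi>) / d"
        by (simp only: norm_scaleR abs_inverse abs_of_pos[OF d(1)] divide_inverse_commute)
      also have "\<dots> \<le> C * d\<^sup>2 / d"
        using taylor[OF that, of "\<xi> + d" \<xi>] d by (intro divide_right_mono) auto
      finally show ?thesis using d by (simp add: power2_eq_square)
    qed
    have "(?q \<longlongrightarrow> ?q t) ?A" by (intro tendsto_intros cont)
    then have "\<forall>\<^sub>F s in ?A. dist (?q s) (?q t) < e / 2"
      using e by (intro tendstoD) auto
    then show "\<forall>\<^sub>F s in ?A. dist (D s \<xi>) (D t \<xi>) < e"
      using ev
    proof eventually_elim
      case (elim s)
      have "dist a b \<le> norm (p - a) + dist p q + norm (q - b)" for a b p q :: 'a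
        unfolding dist_norm by norm
      then have "dist (D s \<xi>) (D t \<xi>) \<le> norm (?q s - D s \<xi>) + dist (?q s) (?q t) + norm (?q t - D t \<xi>)"
        .
      also have "\<dots> < e" using elim q[of s] q[OF t] d by linarith
      finally show ?case .
    qed
  qed
  \<comment> \<open>The remainder is expanded at time \<open>s\<close>, not \<open>t\<close>: the
    quotient along the curve is then the time quotient at the fixed point \<open>c t\<close>, plus
    the slope of \<open>c\<close> times \<open>D s (c t)\<close>, plus the scaled remainder.\<close>
  let ?R = "\<lambda>s. F s (c s) - F s (c t) - (c s - c t) *\<^sub>R D s (c t)"
  have cq: "((\<lambda>s. (c s - c t) / (s - t)) \<longlongrightarrow> c') ?A"
    using c by (simp add: has_field_derivative_iff)
  have cc: "(c \<longlongrightarrow> c t) ?A"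
    using DERIV_continuous[OF c] by (simp add: continuous_within)
  have R: "((\<lambda>s. ?R s /\<^sub>R (s - t)) \<longlongrightarrow> 0) ?A"
  proof (rule Lim_null_comparison)
    show "\<forall>\<^sub>F s in ?A. norm (?R s /\<^sub>R (s - t)) \<le> C * (\<bar>c s - c t\<bar> * \<bar>(c s - c t) / (s - t)\<bar>)"
      using ev
    proof eventually_elim
      case (elim s)
      have "norm (?R s /\<^sub>R (s - t)) \<le> C * (c s - c t)\<^sup>2 * inverse \<bar>s - t\<bar>"
        using taylor[OF elim, of "c s" "c t"] by (simp add: mult_left_mono mult.commute)
      also have "\<dots> = C * (\<bar>c s - c t\<bar> * \<bar>(c s - c t) / (s - t)\<bar>)"
      proof -
        have "(c s - c t)\<^sup>2 = \<bar>c s - c t\<bar> * \<bar>c s - c t\<bar>"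
          by (simp add: power2_eq_square)
        then show ?thesis
          by (simp only: abs_mult abs_inverse divide_inverse mult.assoc)
      qed
      finally show ?case .
    qed
    have "((\<lambda>s. C * (\<bar>c s - c t\<bar> * \<bar>(c s - c t) / (s - t)\<bar>)) \<longlongrightarrow> C * (\<bar>c t - c t\<bar> * \<bar>c'\<bar>)) ?A"
      by (intro tendsto_intros cq cc)
    then show "((\<lambda>s. C * (\<bar>c s - c t\<bar> * \<bar>(c s - c t) / (s - t)\<bar>)) \<longlongrightarrow> 0) ?A" by simp
  qed
  have "((\<lambda>s. (F s (c t) - F t (c t)) /\<^sub>R (s - t) + ((c s - c t) / (s - t)) *\<^sub>R D s (c t) + ?R s /\<^sub>R (s - t))
      \<longlongrightarrow> F' (c t) + c' *\<^sub>R D t (c t) + 0) ?A"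
    using F by (intro tendsto_add tendsto_scaleR cq D R) (simp add: has_vector_derivative_iff_quotient)
  also have "(\<lambda>s. (F s (c t) - F t (c t)) /\<^sub>R (s - t) + ((c s - c t) / (s - t)) *\<^sub>R D s (c t) + ?R s /\<^sub>R (s - t))
      = (\<lambda>s. (F s (c s) - F t (c t)) /\<^sub>R (s - t))"
  proof
    fix s
    have "((c s - c t) / (s - t)) *\<^sub>R D s (c t) = ((c s - c t) *\<^sub>R D s (c t)) /\<^sub>R (s - t)"
      by (simp only: scaleR_scaleR divide_inverse_commute)
    then show "(F s (c t) - F t (c t)) /\<^sub>R (s - t) + ((c s - c t) / (s - t)) *\<^sub>R D s (c t) + ?R s /\<^sub>R (s - t)
        = (F s (c s) - F t (c t)) /\<^sub>R (s - t)"
      by (simp only: scaleR_add_right[symmetric]) simp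
  qed
  finally show ?thesis by (simp add: has_vector_derivative_iff_quotient)
qed

subsection \<open>The Fourier transform of the steady solution\<close>

text \<open>The Gaussian is its own transform, so damping \<open>f\<close> by a wide Gaussian averages \<open>u\<close> against a
  narrow one; then let the width tend to infinity.\<close>
lemma fourier_inversion:
  fixes f u :: "real \<Rightarrow> complex"
  assumes u: "integrable lborel u" "continuous_on UNIV u" "\<And>x. norm (u x) \<le> B"
    and f: "integrable lborel f" "\<And>x. f x = (\<integral>\<eta>. u \<eta> * iexp (\<eta> * x) \<partial>lborel) / (2 * pi)"
  shows "(\<integral>x. f x * iexp (- (x * \<xi>)) \<partial>lborel) = u \<xi>"
proof -
  let ?N = "std_normal_distribution" and ?\<phi> = "std_normal_density"
  interpret N: real_distribution ?N by (rule real_dist_normal_dist)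
  interpret LN: pair_sigma_finite lborel ?N ..
  define E :: "real \<Rightarrow> complex" where "E r = iexp r" for r
  define G :: "real \<Rightarrow> real" where "G y = exp (- y\<^sup>2 / 2)" for y
  define c :: real where "c = sqrt (2 * pi)"
  have [measurable]: "u \<in> borel_measurable borel" "f \<in> borel_measurable borel"
    using u(1) f(1) by (auto dest: borel_measurable_integrable)
  have [measurable]: "E \<in> borel_measurable borel" "G \<in> borel_measurable borel"
    unfolding E_def[abs_def] G_def[abs_def] by measurable
  have E: "E a * E b = E (a + b)" "norm (E a) = 1" for a b
    by (simp_all add: E_def exp_add[symmetric] algebra_simps)
  have c: "0 < c" "c * c = 2 * pi" by (auto simp: c_def)
  have G: "G 0 = 1" "0 \<le> G y" "G y \<le> 1" for y by (auto simp: G_def)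
  have \<phi>: "?\<phi> y = G y / c" for y by (simp add: std_normal_density_def G_def c_def)
  have N: "c * (\<integral>y. h y \<partial>?N) = (\<integral>y. G y * h y \<partial>lborel)"
    if "h \<in> borel_measurable borel" for h :: "real \<Rightarrow> complex"
  proof -
    have "(\<integral>y. h y \<partial>?N) = (\<integral>y. ?\<phi> y *\<^sub>R h y \<partial>lborel)"
      using that by (subst integral_density) auto
    also have "\<dots> = (\<integral>y. (1 / c) *\<^sub>R (G y * h y) \<partial>lborel)"
      by (simp add: \<phi> scaleR_conv_of_real)
    also have "\<dots> = (1 / c) *\<^sub>R (\<integral>y. G y * h y \<partial>lborel)"
      by (rule integral_scaleR_right)
    finally show ?thesis using c by (simp add: scaleR_conv_of_real)
  qed
  have charN: "(\<integral>y. E (a * y) \<partial>?N) = G a" for a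
    using fun_cong[OF char_std_normal_distribution, of a] by (simp add: char_def E_def G_def)
  \<comment> \<open>On the left a Gaussian of width \<open>1 / s\<close> damps \<open>f\<close>; on
    the right \<open>u\<close> is averaged around \<open>\<xi>\<close> at scale \<open>s\<close>.
    Both sides are compared as \<open>s\<close> tends to 0. The identity follows by inserting the
    integral for \<open>f\<close>, exchanging integrals, and evaluating the inner one as the
    characteristic function of the normal law.\<close>
  have smoothed: "(\<integral>x. G (s * x) * (f x * E (- (x * \<xi>))) \<partial>lborel)
      = (\<integral>z. ?\<phi> z *\<^sub>R u (\<xi> + s * z) \<partial>lborel)" if s: "0 < s" for s :: real
  proof -
    have "(\<integral>x. G (s * x) * (f x * E (- (x * \<xi>))) \<partial>lborel)
        = (\<integral>y. G y * (f (y / s) * E (- (y / s * \<xi>))) \<partial>lborel) / s"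
      using s by (subst lborel_integral_real_affine[of "1 / s" _ 0]) (auto simp: scaleR_conv_of_real)
    also have "(\<integral>y. G y * (f (y / s) * E (- (y / s * \<xi>))) \<partial>lborel)
        = c * (\<integral>y. f (y / s) * E (- (y / s * \<xi>)) \<partial>?N)"
      by (rule N[symmetric]) measurable
    also have "(\<integral>y. f (y / s) * E (- (y / s * \<xi>)) \<partial>?N)
        = (\<integral>y. (\<integral>\<eta>. u \<eta> * E ((\<eta> - \<xi>) / s * y) \<partial>lborel) / (2 * pi) \<partial>?N)"
    proof (rule Bochner_Integration.integral_cong[OF refl])
      fix y
      have "f (y / s) * E (- (y / s * \<xi>)) = (\<integral>\<eta>. u \<eta> * E (\<eta> * (y / s)) * E (- (y / s * \<xi>)) \<partial>lborel) / (2 * pi)"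
        unfolding f(2) E_def[symmetric] by (simp add: integral_mult_left_zero)
      also have "(\<lambda>\<eta>. u \<eta> * E (\<eta> * (y / s)) * E (- (y / s * \<xi>))) = (\<lambda>\<eta>. u \<eta> * E ((\<eta> - \<xi>) / s * y))"
        by (simp only: mult.assoc E) (simp add: algebra_simps diff_divide_distrib)
      finally show "f (y / s) * E (- (y / s * \<xi>)) = (\<integral>\<eta>. u \<eta> * E ((\<eta> - \<xi>) / s * y) \<partial>lborel) / (2 * pi)" .
    qed
    also have "\<dots> = (\<integral>y. (\<integral>\<eta>. u \<eta> * E ((\<eta> - \<xi>) / s * y) \<partial>lborel) \<partial>?N) / (2 * pi)"
      by (rule integral_divide_zero)
    also have "(\<integral>y. (\<integral>\<eta>. u \<eta> * E ((\<eta> - \<xi>) / s * y) \<partial>lborel) \<partial>?N)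
        = (\<integral>\<eta>. (\<integral>y. u \<eta> * E ((\<eta> - \<xi>) / s * y) \<partial>?N) \<partial>lborel)"
    proof (rule LN.Fubini_integral, rule LN.Fubini_integrable)
      show "(\<lambda>(\<eta>, y). u \<eta> * E ((\<eta> - \<xi>) / s * y)) \<in> borel_measurable (lborel \<Otimes>\<^sub>M ?N)"
        by measurable
      show "integrable lborel (\<lambda>\<eta>. \<integral>y. norm (case (\<eta>, y) of (\<eta>, y) \<Rightarrow> u \<eta> * E ((\<eta> - \<xi>) / s * y)) \<partial>?N)"
        using u(1) N.prob_space by (simp add: norm_mult E)
      show "AE \<eta> in lborel. integrable ?N (\<lambda>y. case (\<eta>, y) of (\<eta>, y) \<Rightarrow> u \<eta> * E ((\<eta> - \<xi>) / s * y))"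
        by (intro always_eventually allI N.integrable_const_bound[where B="norm (u _)"]) (auto simp: norm_mult E)
    qed
    also have "\<dots> = (\<integral>\<eta>. u \<eta> * G ((\<eta> - \<xi>) / s) \<partial>lborel)"
      by (simp only: integral_mult_right_zero charN)
    also have "\<dots> = s * (\<integral>z. u (\<xi> + s * z) * G z \<partial>lborel)"
      using s by (subst lborel_integral_real_affine[of s _ \<xi>]) (auto simp: scaleR_conv_of_real)
    also have "(\<integral>z. u (\<xi> + s * z) * G z \<partial>lborel) = (\<integral>z. c *\<^sub>R (?\<phi> z *\<^sub>R u (\<xi> + s * z)) \<partial>lborel)"
      using c by (simp add: \<phi> scaleR_conv_of_real mult.commute)
    also have "\<dots> = c * (\<integral>z. ?\<phi> z *\<^sub>R u (\<xi> + s * z) \<partial>lborel)"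
      by (simp only: integral_scaleR_right) (simp add: scaleR_conv_of_real)
    \<comment> \<open>One factor \<open>c\<close> comes from turning the Gaussian weight into the
      normal law, the other from turning it back; their product \<open>2 * pi\<close> cancels the
      constant of the inversion formula.\<close>
    also have "c * (s * (c * I) / (2 * pi)) / s = I" for I :: complex
    proof -
      have "c * (s * (c * I) / (2 * pi)) / s = (c * c) * I / (2 * pi)"
        using s by simp
      also have "\<dots> = I" unfolding of_real_mult[symmetric] c(2) by simp
      finally show ?thesis .
    qed
    finally show ?thesis .
  qed
  have lim0: "(\<lambda>n. 1 / real (Suc n)) \<longlonglongrightarrow> 0" by (rule lim_1_over_n[THEN LIMSEQ_Suc])
  \<comment> \<open>Dominated convergence on each side: by the modulus of \<open>f\<close> on the
    left, by the bound \<open>B\<close> times the normal density on the right, where continuity of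
    \<open>u\<close> gives the pointwise limit.\<close>
  have "(\<lambda>n. \<integral>x. G (1 / real (Suc n) * x) * (f x * E (- (x * \<xi>))) \<partial>lborel)
      \<longlonglongrightarrow> (\<integral>x. G (0 * x) * (f x * E (- (x * \<xi>))) \<partial>lborel)"
  proof (rule integral_dominated_convergence[where w = "\<lambda>x. norm (f x)"])
    show "AE x in lborel. (\<lambda>n. G (1 / real (Suc n) * x) * (f x * E (- (x * \<xi>))))
        \<longlonglongrightarrow> G (0 * x) * (f x * E (- (x * \<xi>)))"
      unfolding G_def by (intro always_eventually allI tendsto_intros lim0) auto
    show "AE x in lborel. norm (G (1 / real (Suc n) * x) * (f x * E (- (x * \<xi>)))) \<le> norm (f x)" for n
      using G by (auto simp: norm_mult E mult_left_le_one_le)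
  qed (use f(1) in auto)
  moreover have "(\<lambda>n. \<integral>z. ?\<phi> z *\<^sub>R u (\<xi> + 1 / real (Suc n) * z) \<partial>lborel)
      \<longlonglongrightarrow> (\<integral>z. ?\<phi> z *\<^sub>R u (\<xi> + 0 * z) \<partial>lborel)"
  proof (rule integral_dominated_convergence[where w = "\<lambda>z. ?\<phi> z * B"])
    show "integrable lborel (\<lambda>z. ?\<phi> z * B)"
      using integrable_std_normal_moment[of 0] by simp
    show "AE z in lborel. (\<lambda>n. ?\<phi> z *\<^sub>R u (\<xi> + 1 / real (Suc n) * z)) \<longlonglongrightarrow> ?\<phi> z *\<^sub>R u (\<xi> + 0 * z)"
      by (intro always_eventually allI tendsto_scaleR tendsto_const
            continuous_on_tendsto_compose[OF u(2)] tendsto_add tendsto_mult lim0) auto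
    show "AE z in lborel. norm (?\<phi> z *\<^sub>R u (\<xi> + 1 / real (Suc n) * z)) \<le> ?\<phi> z * B" for n
      by (auto intro!: mult_left_mono u(3))
  qed auto
  ultimately have "(\<integral>x. G (0 * x) * (f x * E (- (x * \<xi>))) \<partial>lborel)
      = (\<integral>z. ?\<phi> z *\<^sub>R u (\<xi> + 0 * z) \<partial>lborel)"
    by (subst (asm) smoothed) (auto intro: LIMSEQ_unique)
  also have "\<dots> = u \<xi>"
    using integral_std_normal_moment_even[of 0] by (simp add: integral_scaleR_left)
  finally show ?thesis by (simp add: G E_def)
qed

text \<open>With \<open>a = 1 - \<i> * x\<close> the integrand is
  \<open>(1 + \<eta>) * exp (- a * \<eta>)\<close>, which has an elementary primitive. Since
  \<open>a\<close> has real part 1, that primitive vanishes at infinity, and minus its value at 0 is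
  the integral.\<close>

lemma laplace_one_plus:
  fixes x :: real
  shows "has_bochner_integral lborel (\<lambda>\<eta>. indicator {0..} \<eta> *\<^sub>R (complex_of_real ((1 + \<eta>) * exp (- \<eta>)) * iexp (\<eta> * x)))
    (1 / (1 - \<i> * x) + 1 / (1 - \<i> * x)\<^sup>2)"
proof -
  define a where "a = 1 - \<i> * complex_of_real x"
  have a0: "a \<noteq> 0" by (auto simp: a_def complex_eq_iff)
  let ?f = "\<lambda>\<eta>. complex_of_real ((1 + \<eta>) * exp (- \<eta>)) * iexp (\<eta> * x)"
  \<comment> \<open>Primitive of \<open>?f\<close> found by integration by parts.\<close>
  let ?F = "\<lambda>\<eta>. - (complex_of_real (1 + \<eta>) / a + 1 / a\<^sup>2) * exp (- a * complex_of_real \<eta>)"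
  \<comment> \<open>The modulus of the integrand on the half-line; it dominates all the truncated
    integrals.\<close>
  let ?w = "\<lambda>\<eta>::real. indicator {0..} \<eta> * ((1 + \<eta>) * exp (- \<eta>))"
  have f: "?f \<eta> = complex_of_real (1 + \<eta>) * exp (- a * complex_of_real \<eta>)" for \<eta>
    by (simp add: a_def ring_distribs mult.assoc flip: exp_of_real exp_add) (simp add: mult.commute mult.left_commute)
  have F: "(?F has_vector_derivative ?f \<eta>) (at \<eta> within S)" for \<eta> S
  proof -
    have "(?F has_vector_derivative - (1 / a) * exp (- a * complex_of_real \<eta>)
        + - (complex_of_real (1 + \<eta>) / a + 1 / a\<^sup>2) * (- a * exp (- a * complex_of_real \<eta>))) (at \<eta> within S)"
      using a0 by (auto intro!: derivative_eq_intros has_vector_derivative_real_field)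
    also have "- (1 / a) * exp (- a * complex_of_real \<eta>)
        + - (complex_of_real (1 + \<eta>) / a + 1 / a\<^sup>2) * (- a * exp (- a * complex_of_real \<eta>)) = ?f \<eta>"
      unfolding f using a0 by (simp add: divide_simps power2_eq_square) (simp add: algebra_simps)
    finally show ?thesis .
  qed
  have w: "integrable lborel ?w"
  proof -
    have "has_bochner_integral lborel (\<lambda>\<eta>. \<eta> ^ 0 * exp (- \<eta>) * indicator {0..} \<eta> + \<eta> ^ 1 * exp (- \<eta>) * indicator {0..} \<eta> :: real) (fact 0 + fact 1)"
      by (intro has_bochner_integral_add has_bochner_integral_I0i_power_exp_m')
    also have "(\<lambda>\<eta>. \<eta> ^ 0 * exp (- \<eta>) * indicator {0..} \<eta> + \<eta> ^ 1 * exp (- \<eta>) * indicator {0..} \<eta> :: real) = ?w"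
      by (auto simp: fun_eq_iff algebra_simps)
    finally show ?thesis by (rule integrable.intros)
  qed
  let ?g = "\<lambda>\<eta>. indicator {0..} \<eta> *\<^sub>R ?f \<eta>"
  have norm_f: "norm (?f \<eta>) = \<bar>1 + \<eta>\<bar> * exp (- \<eta>)" for \<eta>
    by (simp add: norm_mult abs_mult del: of_real_add)
  have int: "integrable lborel ?g"
    by (rule Bochner_Integration.integrable_bound[OF w]) (auto simp: norm_f indicator_def simp del: of_real_mult of_real_add)
  have lim: "((\<lambda>T. \<integral>\<eta>. indicator {0..T} \<eta> *\<^sub>R ?f \<eta> \<partial>lborel) \<longlongrightarrow> integral\<^sup>L lborel ?g) at_top"
  proof (rule integral_dominated_convergence_at_top[OF _ _ w])
    show "\<forall>\<^sub>F T in at_top. AE \<eta> in lborel. norm (indicator {0..T} \<eta> *\<^sub>R ?f \<eta>) \<le> ?w \<eta>"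
      by (auto simp: norm_f indicator_def simp del: of_real_mult of_real_add)
    show "AE \<eta> in lborel. ((\<lambda>T. indicator {0..T} \<eta> *\<^sub>R ?f \<eta>) \<longlongrightarrow> ?g \<eta>) at_top"
    proof (rule always_eventually, rule allI, rule tendsto_eventually)
      fix \<eta> :: real
      show "\<forall>\<^sub>F T in at_top. indicator {0..T} \<eta> *\<^sub>R ?f \<eta> = ?g \<eta>"
        using eventually_ge_at_top[of \<eta>] by eventually_elim (auto simp: indicator_def)
    qed
  qed auto
  have ev: "\<forall>\<^sub>F T in at_top. ?F T - ?F 0 = (\<integral>\<eta>. indicator {0..T} \<eta> *\<^sub>R ?f \<eta> \<partial>lborel)"
    using eventually_ge_at_top[of 0]
  proof eventually_elim
    case (elim T)
    have "continuous_on {0..T} ?f" by (intro continuous_intros)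
    from integral_FTC_atLeastAtMost[where F = ?F and f = ?f, OF elim F this] show ?case by simp
  qed
  have "((\<lambda>T. ?F T - ?F 0) \<longlongrightarrow> 0 - ?F 0) at_top"
  proof (rule tendsto_diff[OF Lim_null_comparison tendsto_const])
    let ?b = "\<lambda>T::real. (1 / norm a + 1 / (norm a)\<^sup>2) * (T ^ 0 / exp T) + 1 / norm a * (T ^ 1 / exp T)"
    show "(?b \<longlongrightarrow> 0) at_top"
      by (rule tendsto_add_zero; rule tendsto_mult_right_zero; rule tendsto_power_div_exp_0)
    show "\<forall>\<^sub>F T in at_top. norm (?F T) \<le> ?b T"
      using eventually_ge_at_top[of 0]
    proof eventually_elim
      case (elim T)
      have "norm (exp (- a * complex_of_real T)) = exp (- T)"
        by (simp add: a_def)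
      then have "norm (?F T) = norm (complex_of_real (1 + T) / a + 1 / a\<^sup>2) * exp (- T)"
        by (simp only: norm_mult norm_minus_cancel)
      also have "\<dots> \<le> ((1 + T) / norm a + 1 / (norm a)\<^sup>2) * exp (- T)"
        using elim by (intro mult_right_mono order_trans[OF norm_triangle_ineq])
          (auto simp: norm_divide norm_power simp del: of_real_add)
      also have "\<dots> = ?b T" by (simp add: exp_minus divide_inverse algebra_simps)
      finally show ?case .
    qed
  qed
  then have "((\<lambda>T. \<integral>\<eta>. indicator {0..T} \<eta> *\<^sub>R ?f \<eta> \<partial>lborel) \<longlongrightarrow> 0 - ?F 0) at_top"
    by (rule Lim_transform_eventually[OF _ ev])
  with lim have "integral\<^sup>L lborel ?g = 0 - ?F 0"
    by (rule tendsto_unique[OF trivial_limit_at_top_linorder])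
  then show ?thesis
    using int by (simp add: has_bochner_integral_iff a_def)
qed

text \<open>Real-valued, so that its bounds and its evolution are real calculus;
  \<open>fourier_H\<close> identifies it with the transform of \<open>H\<close>.\<close>

definition H_hat :: "real \<Rightarrow> real" where
  "H_hat \<xi> = (1 + \<bar>\<xi>\<bar>) * exp (- \<bar>\<xi>\<bar>)"

lemma H_hat_bounds: "0 \<le> H_hat \<xi>" "H_hat \<xi> \<le> 1"
  using exp_ge_add_one_self[of "\<bar>\<xi>\<bar>"] by (auto simp: H_hat_def exp_minus field_simps)

text \<open>\<open>H_hat\<close> is even: the cosine part over the line is twice the half-line
  integral and the sine part cancels. Thus only the real part of the Laplace integral matters, and
  it is found by multiplying with the conjugate of \<open>1 - \<i> * x\<close>.\<close>

lemma H_hat_integral: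
  "has_bochner_integral lborel (\<lambda>\<eta>. complex_of_real (H_hat \<eta>) * iexp (\<eta> * x)) (complex_of_real (4 / (1 + x\<^sup>2)\<^sup>2))"
proof -
  let ?a = "1 - \<i> * complex_of_real x"
  let ?J = "1 / ?a + 1 / ?a\<^sup>2"
  let ?f = "\<lambda>\<eta>. complex_of_real ((1 + \<eta>) * exp (- \<eta>)) * iexp (\<eta> * x)"
  have pos: "0 < 1 + x\<^sup>2" by (simp add: add_pos_nonneg)
  have "?a * (1 + \<i> * complex_of_real x) = complex_of_real (1 + x\<^sup>2)"
    by (simp add: algebra_simps power2_eq_square)
  moreover have "?a \<noteq> 0" by (auto simp: complex_eq_iff)
  ultimately have inv: "1 / ?a = (1 + \<i> * complex_of_real x) / complex_of_real (1 + x\<^sup>2)"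
    using pos by (simp add: field_simps del: of_real_add)
  have "?J = 1 / ?a + (1 / ?a)\<^sup>2" by (simp add: power_divide)
  then have "?J = (1 + \<i> * complex_of_real x) / complex_of_real (1 + x\<^sup>2)
      + (1 + \<i> * complex_of_real x)\<^sup>2 / complex_of_real ((1 + x\<^sup>2)\<^sup>2)"
    unfolding inv by (simp add: power_divide)
  then have "Re ?J = 1 / (1 + x\<^sup>2) + (1 - x\<^sup>2) / (1 + x\<^sup>2)\<^sup>2"
    by (simp only: plus_complex.sel Re_divide_of_real) (simp add: power2_eq_square)
  also have "1 / (1 + x\<^sup>2) = (1 + x\<^sup>2) / (1 + x\<^sup>2)\<^sup>2"
    using pos by (simp add: power2_eq_square[of "1 + x\<^sup>2"])
  finally have J: "Re ?J = 2 / (1 + x\<^sup>2)\<^sup>2"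
    by (simp flip: add_divide_distrib)
  have part: "has_bochner_integral lborel (\<lambda>\<eta>. indicator {0..} \<eta> *\<^sub>R (H_hat \<eta> * cos (\<eta> * x))) (Re ?J)"
    "has_bochner_integral lborel (\<lambda>\<eta>. indicator {0..} \<eta> *\<^sub>R (H_hat \<eta> * sin (\<eta> * x))) (Im ?J)"
  proof -
    have "Re (?f \<eta>) = (1 + \<eta>) * exp (- \<eta>) * cos (\<eta> * x)" "Im (?f \<eta>) = (1 + \<eta>) * exp (- \<eta>) * sin (\<eta> * x)" for \<eta>
      by (simp_all add: cis_conv_exp[symmetric] del: of_real_mult of_real_add)
    note parts = this
    have eq: "Re (indicator {0..} \<eta> *\<^sub>R ?f \<eta>) = indicator {0..} \<eta> *\<^sub>R (H_hat \<eta> * cos (\<eta> * x))"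
      "Im (indicator {0..} \<eta> *\<^sub>R ?f \<eta>) = indicator {0..} \<eta> *\<^sub>R (H_hat \<eta> * sin (\<eta> * x))" for \<eta>
      by (simp_all only: scaleR_complex.sel parts) (simp_all add: H_hat_def indicator_def)
    show "has_bochner_integral lborel (\<lambda>\<eta>. indicator {0..} \<eta> *\<^sub>R (H_hat \<eta> * cos (\<eta> * x))) (Re ?J)"
      using has_bochner_integral_bounded_linear[OF bounded_linear_Re laplace_one_plus[of x]]
      unfolding eq .
    show "has_bochner_integral lborel (\<lambda>\<eta>. indicator {0..} \<eta> *\<^sub>R (H_hat \<eta> * sin (\<eta> * x))) (Im ?J)"
      using has_bochner_integral_bounded_linear[OF bounded_linear_Im laplace_one_plus[of x]]
      unfolding eq .
  qed
  have "has_bochner_integral lborel (\<lambda>\<eta>. complex_of_real (H_hat \<eta> * cos (\<eta> * x)) + \<i> * complex_of_real (H_hat \<eta> * sin (\<eta> * x)))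
      (complex_of_real (2 *\<^sub>R Re ?J) + \<i> * complex_of_real 0)"
    by (intro has_bochner_integral_add has_bochner_integral_of_real has_bochner_integral_mult_right
        has_bochner_integral_even_function[OF part(1)] has_bochner_integral_odd_function[OF part(2)]) (auto simp: H_hat_def)
  also have "(\<lambda>\<eta>. complex_of_real (H_hat \<eta> * cos (\<eta> * x)) + \<i> * complex_of_real (H_hat \<eta> * sin (\<eta> * x)))
      = (\<lambda>\<eta>. complex_of_real (H_hat \<eta>) * iexp (\<eta> * x))"
    by (simp add: fun_eq_iff complex_eq_iff cis_conv_exp[symmetric] del: of_real_mult)
  finally show ?thesis unfolding J by simp
qed

lemma integrable_H: "integrable lborel H"
proof (rule Bochner_Integration.integrable_bound)
  show "integrable lborel (\<lambda>x::real. 2 / pi * inverse (1 + x\<^sup>2))"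
    using integrable_inverse_1_plus_square by (simp add: set_integrable_def einterval_eq_UNIV)
  show "H \<in> borel_measurable lborel" unfolding H_def[abs_def] by measurable
  show "AE x in lborel. norm (H x) \<le> norm (2 / pi * inverse (1 + x\<^sup>2))"
  proof (intro always_eventually allI)
    fix x :: real
    have "1 * (1 + x\<^sup>2) \<le> (1 + x\<^sup>2)\<^sup>2" unfolding power2_eq_square[of "1 + x\<^sup>2"] by (intro mult_right_mono) auto
    then have "2 / pi * inverse ((1 + x\<^sup>2)\<^sup>2) \<le> 2 / pi * inverse (1 + x\<^sup>2)"
      by (intro mult_left_mono[OF le_imp_inverse_le]) (auto simp: add_pos_nonneg)
    moreover have "H x = 2 / pi * inverse ((1 + x\<^sup>2)\<^sup>2)"
      by (simp add: H_def divide_inverse)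
    moreover have "0 \<le> 2 / pi * inverse ((1 + x\<^sup>2)\<^sup>2)" by simp
    ultimately show "norm (H x) \<le> norm (2 / pi * inverse (1 + x\<^sup>2))"
      by (metis abs_of_nonneg order_trans real_norm_def)
  qed
qed

text \<open>The transform is obtained backwards: integrating \<open>H_hat\<close> against
  exponentials is elementary and yields \<open>2 * pi * H\<close>, so inversion gives the transform
  of \<open>H\<close> itself without contour integration.\<close>

lemma fourier_H: "fourier H \<xi> = complex_of_real (H_hat \<xi>)"
proof -
  have "(\<integral>x. complex_of_real (H x) * iexp (- (x * \<xi>)) \<partial>lborel) = complex_of_real (H_hat \<xi>)"
  proof (rule fourier_inversion[where B = 1])
    show "integrable lborel (\<lambda>\<eta>. complex_of_real (H_hat \<eta>))"
      using integrable.intros[OF H_hat_integral[of 0]] by simp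
    show "continuous_on UNIV (\<lambda>\<eta>. complex_of_real (H_hat \<eta>))"
      unfolding H_hat_def by (intro continuous_intros)
    show "integrable lborel (\<lambda>x. complex_of_real (H x))"
      using integrable_H by simp
    show "complex_of_real (H x) = (\<integral>\<eta>. complex_of_real (H_hat \<eta>) * iexp (\<eta> * x) \<partial>lborel) / (2 * pi)" for x
      unfolding has_bochner_integral_integral_eq[OF H_hat_integral] by (simp add: H_def)
  qed (use H_hat_bounds in simp)
  then show ?thesis by (simp add: fourier_def)
qed

subsection \<open>The equation in Fourier variables\<close>

lemma borel_measurable_cis [measurable]: "cis \<in> borel_measurable borel"
  by (intro borel_measurable_continuous_onI continuous_intros)

lemma cis_taylor: "norm (cis b - cis a - (b - a) *\<^sub>R (\<i> * cis a)) \<le> (b - a)\<^sup>2 / 2"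
proof -
  let ?d = "b - a"
  have "cis b - cis a - ?d *\<^sub>R (\<i> * cis a) = cis a * (cis ?d - (1 + \<i> * ?d))"
    by (simp add: cis_mult algebra_simps scaleR_conv_of_real)
  moreover have "norm (cis ?d - (1 + \<i> * ?d)) \<le> \<bar>?d\<bar>\<^sup>2 / 2"
    using iexp_approx1[of ?d 1] by (simp add: cis_conv_exp numeral_2_eq_2)
  ultimately show ?thesis by (simp add: norm_mult)
qed

lemma fourier_cis: "fourier f \<xi> = (\<integral>x. complex_of_real (f x) * cis (- (x * \<xi>)) \<partial>lborel)"
  by (simp add: fourier_def cis_conv_exp)

lemma integrable_mult_cis:
  assumes "integrable lborel f"
  shows "integrable lborel (\<lambda>x. complex_of_real (f x) * cis (- (x * \<xi>)))"
proof (rule Bochner_Integration.integrable_bound[OF assms])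
  have [measurable]: "f \<in> borel_measurable borel" using assms by auto
  show "(\<lambda>x. complex_of_real (f x) * cis (- (x * \<xi>))) \<in> borel_measurable lborel" by measurable
qed (simp add: norm_mult)

lemma borel_measurable_fourier [measurable]:
  assumes [measurable]: "f \<in> borel_measurable borel"
  shows "fourier f \<in> borel_measurable borel"
  unfolding fourier_cis[abs_def] by measurable

lemma norm_fourier_le:
  assumes "integrable lborel f" "\<And>x. 0 \<le> f x"
  shows "norm (fourier f \<xi>) \<le> integral\<^sup>L lborel f"
  unfolding fourier_cis
proof (rule Bochner_Integration.integral_norm_bound_integral[OF integrable_mult_cis[OF assms(1)] assms(1)])
  show "norm (complex_of_real (f x) * cis (- (x * \<xi>))) \<le> f x" for x
    using assms(2)[of x] by (simp add: norm_mult)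
qed

text \<open>\<open>cis_taylor\<close> is integrated against \<open>f\<close>;
  \<open>- \<i> * fourier (\<lambda>x. x * f x)\<close> is the derivative of the transform. The
  constant depends on the second moment only, so conserved energy makes the expansion uniform in
  time, as \<open>has_vector_derivative_along_curve\<close> requires.\<close>

lemma fourier_taylor:
  assumes f: "\<And>x. 0 \<le> f x" "integrable lborel f" "integrable lborel (\<lambda>x. x * f x)" "integrable lborel (\<lambda>x. x\<^sup>2 * f x)"
  shows "norm (fourier f \<eta> - fourier f \<xi> - (\<eta> - \<xi>) *\<^sub>R (- \<i> * fourier (\<lambda>x. x * f x) \<xi>))
    \<le> (\<integral>x. x\<^sup>2 * f x \<partial>lborel) / 2 * (\<eta> - \<xi>)\<^sup>2"
proof -
  let ?r = "\<lambda>x. complex_of_real (f x) * cis (- (x * \<eta>)) - complex_of_real (f x) * cis (- (x * \<xi>))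
      - (\<eta> - \<xi>) *\<^sub>R (- \<i> * (complex_of_real (x * f x) * cis (- (x * \<xi>))))"
  note i1 = integrable_mult_cis[OF f(2), of \<eta>] and i2 = integrable_mult_cis[OF f(2), of \<xi>]
  have i3: "integrable lborel (\<lambda>x. (\<eta> - \<xi>) *\<^sub>R (- \<i> * (complex_of_real (x * f x) * cis (- (x * \<xi>)))))"
    by (rule integrable_scaleR_right[OF integrable_mult_right[OF integrable_mult_cis[OF f(3)]]])
  note int = Bochner_Integration.integrable_diff[OF Bochner_Integration.integrable_diff[OF i1 i2] i3]
  have "norm (fourier f \<eta> - fourier f \<xi> - (\<eta> - \<xi>) *\<^sub>R (- \<i> * fourier (\<lambda>x. x * f x) \<xi>)) = norm (integral\<^sup>L lborel ?r)"
    unfolding fourier_cis Bochner_Integration.integral_diff[OF Bochner_Integration.integrable_diff[OF i1 i2] i3]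
      Bochner_Integration.integral_diff[OF i1 i2] integral_scaleR_right integral_mult_right_zero ..
  also have "\<dots> \<le> (\<integral>x. (\<eta> - \<xi>)\<^sup>2 / 2 * (x\<^sup>2 * f x) \<partial>lborel)"
  proof (rule Bochner_Integration.integral_norm_bound_integral[OF int])
    show "integrable lborel (\<lambda>x. (\<eta> - \<xi>)\<^sup>2 / 2 * (x\<^sup>2 * f x))"
      using f(4) by (rule integrable_mult_right)
    fix x
    have "?r x = complex_of_real (f x) * (cis (- (x * \<eta>)) - cis (- (x * \<xi>)) - (- (x * \<eta>) - - (x * \<xi>)) *\<^sub>R (\<i> * cis (- (x * \<xi>))))"
      by (simp add: algebra_simps scaleR_conv_of_real)
    then have "norm (?r x) \<le> f x * ((- (x * \<eta>) - - (x * \<xi>))\<^sup>2 / 2)"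
      using f(1)[of x] by (simp only: norm_mult norm_of_real abs_of_nonneg) (intro mult_left_mono cis_taylor)
    also have "\<dots> = (\<eta> - \<xi>)\<^sup>2 / 2 * (x\<^sup>2 * f x)"
      by (simp add: power2_eq_square algebra_simps)
    finally show "norm (?r x) \<le> (\<eta> - \<xi>)\<^sup>2 / 2 * (x\<^sup>2 * f x)" .
  qed
  also have "(\<integral>x. (\<eta> - \<xi>)\<^sup>2 / 2 * (x\<^sup>2 * f x) \<partial>lborel) = (\<eta> - \<xi>)\<^sup>2 / 2 * (\<integral>x. x\<^sup>2 * f x \<partial>lborel)"
    by (rule integral_mult_right_zero)
  also have "\<dots> = (\<integral>x. x\<^sup>2 * f x \<partial>lborel) / 2 * (\<eta> - \<xi>)\<^sup>2"
    by simp
  finally show ?thesis .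
qed

text \<open>Test functions are real, so the weak formulation is applied to \<open>P\<close> of the
  character \<open>cis (- (x * \<xi>))\<close>; \<open>P\<close> stands for the real and the
  imaginary part, which are thus treated at once. The drift becomes the frequency derivative of the
  transform. The gain term becomes a square because the character at a midpoint factorises, and with
  unit mass the two loss terms add up to the transform itself.\<close>

lemma weak_solution_fourier_component:
  fixes g :: "real \<Rightarrow> real \<Rightarrow> real" and P :: "complex \<Rightarrow> real"
  assumes meas: "\<And>t. 0 \<le> t \<Longrightarrow> g t \<in> borel_measurable borel"
    and nonneg: "\<And>t x. 0 \<le> t \<Longrightarrow> 0 \<le> g t x"
    and sol: "weak_solution (\<lambda>t. density lborel (\<lambda>x. ennreal (g t x)))"
    and mass: "\<And>t. 0 \<le> t \<Longrightarrow> has_bochner_integral lborel (g t) 1"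
    and momentum: "\<And>t. 0 \<le> t \<Longrightarrow> integrable lborel (\<lambda>x. x * g t x)"
    and P: "bounded_linear P" and t: "0 \<le> t"
  shows "((\<lambda>s. P (fourier (g s) \<xi>)) has_real_derivative
      P ((\<xi> / 4) *\<^sub>R (- \<i> * fourier (\<lambda>x. x * g t x) \<xi>) + ((fourier (g t) (\<xi> / 2))\<^sup>2 - fourier (g t) \<xi>)))
    (at t within {0..})"
proof -
  interpret P: bounded_linear P by (rule P)
  define \<mu> where "\<mu> t = density lborel (\<lambda>x. ennreal (g t x))" for t
  have \<mu>_integral: "(\<integral>x. h x \<partial>\<mu> s) = (\<integral>x. g s x *\<^sub>R h x \<partial>lborel)"
    if "0 \<le> s" "h \<in> borel_measurable borel" for s and h :: "real \<Rightarrow> complex"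
    unfolding \<mu>_def using that meas[of s] nonneg[of s] by (subst integral_density) auto
  have sets[measurable_cong, simp]: "sets (\<mu> s) = sets borel" for s by (simp add: \<mu>_def)
  have space[simp]: "space (\<mu> s) = UNIV" for s by (simp add: \<mu>_def)
  have prob: "prob_space (\<mu> s)" if "0 \<le> s" for s
  proof
    have "emeasure (\<mu> s) (space (\<mu> s)) = (\<integral>\<^sup>+x. ennreal (g s x) \<partial>lborel)"
      unfolding \<mu>_def using meas[OF that] by (simp add: emeasure_density)
    also have "\<dots> = ennreal 1"
      using mass[OF that] nonneg[OF that] by (subst nn_integral_eq_integral) (auto simp: has_bochner_integral_iff)
    finally show "emeasure (\<mu> s) (space (\<mu> s)) = 1" by simp
  qed
  interpret \<mu>t: prob_space "\<mu> t" by (rule prob[OF t])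
  interpret \<mu>\<mu>: pair_prob_space "\<mu> t" "\<mu> t" ..
  define c where "c x = cis (- (x * \<xi>))" for x
  define \<phi> where "\<phi> x = P (c x)" for x
  have c_meas[measurable]: "c \<in> borel_measurable borel" unfolding c_def[abs_def] by measurable
  have [measurable]: "P \<in> borel_measurable borel"
    by (intro borel_measurable_continuous_onI P.continuous_on continuous_intros)
  have norm_c: "norm (c x) = 1" for x by (simp add: c_def)
  have c_deriv: "(c has_vector_derivative (- \<xi>) *\<^sub>R (\<i> * c x)) (at x)" for x
  proof -
    have "c = (\<lambda>x. exp (- \<i> * complex_of_real \<xi> * complex_of_real x))"
      by (simp add: c_def[abs_def] cis_conv_exp fun_eq_iff algebra_simps)
    moreover have "((\<lambda>x. exp (- \<i> * complex_of_real \<xi> * complex_of_real x)) has_vector_derivative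
        - \<i> * complex_of_real \<xi> * exp (- \<i> * complex_of_real \<xi> * complex_of_real x)) (at x)"
      by (auto intro!: derivative_eq_intros has_vector_derivative_real_field)
    ultimately show ?thesis by (simp add: scaleR_conv_of_real mult_ac)
  qed
  have \<phi>_deriv: "(\<phi> has_real_derivative P ((- \<xi>) *\<^sub>R (\<i> * c x))) (at x)" for x
    unfolding \<phi>_def[abs_def] has_real_derivative_iff_has_vector_derivative
    using P.has_vector_derivative[OF c_deriv] .
  then have deriv_\<phi>: "deriv \<phi> = (\<lambda>x. P ((- \<xi>) *\<^sub>R (\<i> * c x)))"
    by (auto simp: fun_eq_iff intro: DERIV_imp_deriv)
  obtain K where K: "\<And>z. norm (P z) \<le> norm z * K" using P.bounded by blast
  have cont_c: "continuous_on UNIV c" unfolding c_def by (intro continuous_intros)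
  have "\<phi> \<in> C1b"
    unfolding C1b_def
  proof (intro CollectI conjI allI)
    show "\<phi> differentiable at x" for x
      using \<phi>_deriv real_differentiable_def by blast
    show "continuous_on UNIV (deriv \<phi>)"
      unfolding deriv_\<phi> by (intro P.continuous_on continuous_intros cont_c)
    show "bounded (range \<phi>)"
      using K[of "c _"] by (intro boundedI[of _ K]) (auto simp: \<phi>_def norm_c)
    show "bounded (range (deriv \<phi>))"
      using K[of "(- \<xi>) *\<^sub>R (\<i> * c _)"] by (intro boundedI[of _ "\<bar>\<xi>\<bar> * K"]) (auto simp: deriv_\<phi> norm_c norm_mult)
  qed
  then have main: "((\<lambda>s. \<integral>x. \<phi> x \<partial>\<mu> s) has_real_derivative
      1/4 * (\<integral>x. x * deriv \<phi> x \<partial>\<mu> t) + collision_weak (\<mu> t) \<phi>) (at t within {0..})"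
    using sol t by (simp add: weak_solution_def \<mu>_def)
  have int_c: "integrable (\<mu> s) c" if "0 \<le> s" for s
  proof -
    interpret prob_space "\<mu> s" by (rule prob[OF that])
    show ?thesis by (rule integrable_const_bound[of _ 1]) (auto simp: norm_c)
  qed
  have \<mu>_cis: "(\<integral>x. cis (- (x * \<zeta>)) \<partial>\<mu> s) = fourier (g s) \<zeta>" if "0 \<le> s" for s \<zeta>
    using that by (subst \<mu>_integral) (auto simp: fourier_cis scaleR_conv_of_real)
  have test: "(\<integral>x. \<phi> x \<partial>\<mu> s) = P (fourier (g s) \<xi>)" if "0 \<le> s" for s
    unfolding \<phi>_def using \<mu>_cis[OF that, of \<xi>] integral_bounded_linear[OF P int_c[OF that]] by (simp add: c_def[abs_def])
  have drift: "(\<integral>x. x * deriv \<phi> x \<partial>\<mu> t) = P (\<xi> *\<^sub>R (- \<i> * fourier (\<lambda>x. x * g t x) \<xi>))"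
  proof -
    have eq: "x * deriv \<phi> x = P (x *\<^sub>R ((- \<xi>) *\<^sub>R (\<i> * c x)))" for x
      by (simp only: deriv_\<phi> P.scaleR real_scaleR_def)
    \<comment> \<open>The drift integrand grows linearly in \<open>x\<close>; the first moment makes
      it integrable.\<close>
    have int: "integrable lborel (\<lambda>x. (- \<xi>) *\<^sub>R (\<i> * (complex_of_real (x * g t x) * c x)))"
      unfolding c_def by (intro integrable_scaleR_right integrable_mult_right integrable_mult_cis momentum t)
    have eq2: "g t x *\<^sub>R (x *\<^sub>R ((- \<xi>) *\<^sub>R (\<i> * c x))) = (- \<xi>) *\<^sub>R (\<i> * (complex_of_real (x * g t x) * c x))" for x
      by (simp add: scaleR_conv_of_real mult_ac)
    have "integrable (\<mu> t) (\<lambda>x. x *\<^sub>R ((- \<xi>) *\<^sub>R (\<i> * c x)))"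
      unfolding \<mu>_def
    proof (subst integrable_density)
      show "integrable lborel (\<lambda>x. g t x *\<^sub>R (x *\<^sub>R ((- \<xi>) *\<^sub>R (\<i> * c x))))"
        unfolding eq2 by (rule int)
    qed (use meas[OF t] nonneg[OF t] in auto)
    then have "(\<integral>x. x * deriv \<phi> x \<partial>\<mu> t) = P (\<integral>x. x *\<^sub>R ((- \<xi>) *\<^sub>R (\<i> * c x)) \<partial>\<mu> t)"
      unfolding eq by (rule integral_bounded_linear[OF P])
    also have "(\<integral>x. x *\<^sub>R ((- \<xi>) *\<^sub>R (\<i> * c x)) \<partial>\<mu> t) = (\<integral>x. g t x *\<^sub>R (x *\<^sub>R ((- \<xi>) *\<^sub>R (\<i> * c x))) \<partial>lborel)"
      by (rule \<mu>_integral[OF t]) measurable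
    also have "\<dots> = (- \<xi>) *\<^sub>R (\<i> * fourier (\<lambda>x. x * g t x) \<xi>)"
      unfolding eq2 by (simp only: integral_scaleR_right integral_mult_right_zero fourier_cis c_def)
    also have "\<dots> = \<xi> *\<^sub>R (- \<i> * fourier (\<lambda>x. x * g t x) \<xi>)" by simp
    finally show ?thesis .
  qed
  have coll: "collision_weak (\<mu> t) \<phi> = P ((fourier (g t) (\<xi> / 2))\<^sup>2 - fourier (g t) \<xi>)"
  proof -
    \<comment> \<open>The character at half the frequency: its product at \<open>x\<close> and
      \<open>y\<close> is \<open>c\<close> at the midpoint, so the gain integral over the product
      measure splits into two equal factors.\<close>
    define e where "e x = cis (- (x * (\<xi> / 2)))" for x
    have [measurable]: "e \<in> borel_measurable borel" unfolding e_def[abs_def] by measurable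
    have e_int: "(\<integral>x. e x \<partial>\<mu> t) = fourier (g t) (\<xi> / 2)" unfolding e_def by (rule \<mu>_cis[OF t])
    have c_int: "(\<integral>x. c x \<partial>\<mu> t) = fourier (g t) \<xi>" unfolding c_def by (rule \<mu>_cis[OF t])
    have norm_e: "norm (e x) = 1" for x by (simp add: e_def)
    have ce: "c ((x + y) / 2) = e x * e y" for x y
    proof -
      have "- ((x + y) / 2 * \<xi>) = - (x * (\<xi> / 2)) + - (y * (\<xi> / 2))" by (simp add: field_simps)
      then show ?thesis by (simp only: c_def e_def cis_mult)
    qed
    have i1: "integrable (\<mu> t \<Otimes>\<^sub>M \<mu> t) (\<lambda>z. e (fst z) * e (snd z))"
      by (rule \<mu>\<mu>.integrable_const_bound[of _ 1]) (auto simp: norm_e norm_mult)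
    have i2: "integrable (\<mu> t \<Otimes>\<^sub>M \<mu> t) (\<lambda>z. c (fst z))" "integrable (\<mu> t \<Otimes>\<^sub>M \<mu> t) (\<lambda>z. c (snd z))"
      by (rule \<mu>\<mu>.integrable_const_bound[of _ 1]; auto simp: norm_c)+
    have "collision_weak (\<mu> t) \<phi> = (\<integral>z. P (e (fst z) * e (snd z) - (1/2) *\<^sub>R c (fst z) - (1/2) *\<^sub>R c (snd z)) \<partial>(\<mu> t \<Otimes>\<^sub>M \<mu> t))"
      unfolding collision_weak_def
      by (intro Bochner_Integration.integral_cong) (auto simp: \<phi>_def ce[symmetric] P.diff P.scaleR)
    also have "\<dots> = P (\<integral>z. e (fst z) * e (snd z) - (1/2) *\<^sub>R c (fst z) - (1/2) *\<^sub>R c (snd z) \<partial>(\<mu> t \<Otimes>\<^sub>M \<mu> t))"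
      by (rule integral_bounded_linear[OF P]) (intro Bochner_Integration.integrable_diff integrable_scaleR_right i1 i2)
    also have "(\<integral>z. e (fst z) * e (snd z) - (1/2) *\<^sub>R c (fst z) - (1/2) *\<^sub>R c (snd z) \<partial>(\<mu> t \<Otimes>\<^sub>M \<mu> t))
        = (\<integral>z. e (fst z) * e (snd z) \<partial>(\<mu> t \<Otimes>\<^sub>M \<mu> t)) - (1/2) *\<^sub>R (\<integral>z. c (fst z) \<partial>(\<mu> t \<Otimes>\<^sub>M \<mu> t))
          - (1/2) *\<^sub>R (\<integral>z. c (snd z) \<partial>(\<mu> t \<Otimes>\<^sub>M \<mu> t))"
      by (simp only: Bochner_Integration.integral_diff Bochner_Integration.integrable_diff integrable_scaleR_right integral_scaleR_right i1 i2)
    also have "(\<integral>z. e (fst z) * e (snd z) \<partial>(\<mu> t \<Otimes>\<^sub>M \<mu> t)) = (fourier (g t) (\<xi> / 2))\<^sup>2"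
      using \<mu>\<mu>.integral_fst'[OF i1] e_int by (simp add: power2_eq_square)
    also have "(\<integral>z. c (fst z) \<partial>(\<mu> t \<Otimes>\<^sub>M \<mu> t)) = fourier (g t) \<xi>"
      using \<mu>\<mu>.integral_fst'[OF i2(1)] c_int \<mu>t.prob_space by simp
    also have "(\<integral>z. c (snd z) \<partial>(\<mu> t \<Otimes>\<^sub>M \<mu> t)) = fourier (g t) \<xi>"
      using \<mu>\<mu>.integral_fst'[OF i2(2)] c_int \<mu>t.prob_space by simp
    finally show ?thesis by (simp add: scaleR_conv_of_real)
  qed
  have "((\<lambda>s. P (fourier (g s) \<xi>)) has_real_derivative
      1/4 * (\<integral>x. x * deriv \<phi> x \<partial>\<mu> t) + collision_weak (\<mu> t) \<phi>) (at t within {0..})"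
    by (rule has_field_derivative_transform_within[OF main zero_less_one]) (use t in \<open>auto simp: test\<close>)
  then show ?thesis
    unfolding drift coll by (simp add: P.add P.diff P.scaleR linear_neg[OF P.linear])
qed

lemma weak_solution_fourier:
  fixes g :: "real \<Rightarrow> real \<Rightarrow> real"
  assumes meas: "\<And>t. 0 \<le> t \<Longrightarrow> g t \<in> borel_measurable borel"
    and nonneg: "\<And>t x. 0 \<le> t \<Longrightarrow> 0 \<le> g t x"
    and sol: "weak_solution (\<lambda>t. density lborel (\<lambda>x. ennreal (g t x)))"
    and mass: "\<And>t. 0 \<le> t \<Longrightarrow> has_bochner_integral lborel (g t) 1"
    and momentum: "\<And>t. 0 \<le> t \<Longrightarrow> integrable lborel (\<lambda>x. x * g t x)"
    and t: "0 \<le> t"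
  shows "((\<lambda>s. fourier (g s) \<xi>) has_vector_derivative
      (\<xi> / 4) *\<^sub>R (- \<i> * fourier (\<lambda>x. x * g t x) \<xi>) + ((fourier (g t) (\<xi> / 2))\<^sup>2 - fourier (g t) \<xi>))
    (at t within {0..})"
    (is "(?F has_vector_derivative ?d) _")
proof -
  note component = weak_solution_fourier_component[OF meas nonneg sol mass momentum _ t, where \<xi> = \<xi>]
  have "((\<lambda>s. complex_of_real (Re (?F s)) + \<i> * complex_of_real (Im (?F s))) has_vector_derivative
      complex_of_real (Re ?d) + \<i> * complex_of_real (Im ?d)) (at t within {0..})"
    by (intro has_vector_derivative_add has_vector_derivative_mult_right has_vector_derivative_of_real component
        bounded_linear_Re bounded_linear_Im)
  then show ?thesis by (simp only: complex_eq[symmetric])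
qed

section \<open>Comparison with the steady solution along characteristics\<close>

text \<open>Stationarity of \<open>H_hat\<close>, written along a characteristic so that the
  transport term is absorbed by the motion. The sign of the frequency is constant on the curve, so
  the modulus can be taken once, in \<open>r\<close>, and its kink at 0 does not interfere. Both
  sides equal \<open>r\<^sup>2 / 4 * exp (- r)\<close>.\<close>

lemma H_hat_curve_derivative:
  "((\<lambda>s. H_hat (a * exp (- s / 4))) has_real_derivative
    (H_hat (a * exp (- t / 4) / 2))\<^sup>2 - H_hat (a * exp (- t / 4))) (at t within S)"
proof -
  define r where "r s = \<bar>a\<bar> * exp (- s / 4)" for s
  have H: "H_hat (a * exp (- s / 4)) = (1 + r s) * exp (- r s)"
    "H_hat (a * exp (- s / 4) / 2) = (1 + r s / 2) * exp (- (r s / 2))" for s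
    by (simp_all add: H_hat_def r_def abs_mult)
  have r': "(r has_real_derivative - r t / 4) (at t within S)"
    unfolding r_def[abs_def] by (auto intro!: derivative_eq_intros)
  have "((\<lambda>s. (1 + r s) * exp (- r s)) has_real_derivative
      (- r t / 4) * exp (- r t) + exp (- r t) * (- (- r t / 4)) * (1 + r t)) (at t within S)"
    by (rule derivative_eq_intros r' refl)+ simp
  also have "(- r t / 4) * exp (- r t) + exp (- r t) * (- (- r t / 4)) * (1 + r t)
      = ((1 + r t / 2) * exp (- (r t / 2)))\<^sup>2 - (1 + r t) * exp (- r t)"
  proof -
    have "(exp (- (r t / 2)))\<^sup>2 = exp (- r t)" by (simp add: power2_eq_square exp_add[symmetric])
    then show ?thesis unfolding power_mult_distrib by (simp add: power2_eq_square algebra_simps)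
  qed
  finally show ?thesis unfolding H .
qed

text \<open>Characteristics contract frequencies by \<open>exp (- s / 4)\<close>, and the gain term
  looks at half the frequency. Following the curves through all \<open>\<xi> / 2 ^ n\<close> gives a
  family closed under halving, to which \<open>iterated_growth_bound\<close> applies with
  \<open>c = 2\<close>.\<close>

lemma dominated_by_initial:
  fixes g :: "real \<Rightarrow> real \<Rightarrow> real"
  assumes meas: "\<And>t. 0 \<le> t \<Longrightarrow> g t \<in> borel_measurable borel"
    and nonneg: "\<And>t x. 0 \<le> t \<Longrightarrow> 0 \<le> g t x"
    and sol: "weak_solution (\<lambda>t. density lborel (\<lambda>x. ennreal (g t x)))"
    and mass: "\<And>t. 0 \<le> t \<Longrightarrow> has_bochner_integral lborel (g t) 1"
    and momentum: "\<And>t. 0 \<le> t \<Longrightarrow> integrable lborel (\<lambda>x. x * g t x)"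
    and energy: "\<And>t. 0 \<le> t \<Longrightarrow> has_bochner_integral lborel (\<lambda>x. x\<^sup>2 * g t x) 1"
    and t: "0 \<le> t"
  shows "cmod (fourier (g t) \<xi> - fourier H \<xi>) \<le>
     (\<Sum>j<m. exp (- t) * (2 * t) ^ j / fact j * cmod (fourier (g 0) (exp (t / 4) / 2 ^ j * \<xi>) - fourier H (exp (t / 4) / 2 ^ j * \<xi>)))
       + 2 * ((2 * t) ^ m / fact m)"
proof -
  let ?F = "\<lambda>s \<xi>. fourier (g s) \<xi>" and ?D = "\<lambda>s \<xi>. - \<i> * fourier (\<lambda>x. x * g s x) \<xi>"
  have F_le: "cmod (?F s \<xi>) \<le> 1" if "0 \<le> s" for s \<xi>
    using norm_fourier_le[of "g s" \<xi>] mass[OF that] nonneg[OF that] by (simp add: has_bochner_integral_iff)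
  have u_le: "cmod (complex_of_real (H_hat \<xi>)) \<le> 1" for \<xi>
    using H_hat_bounds[of \<xi>] by simp
  have taylor: "norm (?F s \<eta> - ?F s \<xi> - (\<eta> - \<xi>) *\<^sub>R ?D s \<xi>) \<le> 1 / 2 * (\<eta> - \<xi>)\<^sup>2" if "0 \<le> s" for s \<xi> \<eta>
    using fourier_taylor[of "g s" \<eta> \<xi>] mass[OF that] nonneg[OF that] momentum[OF that] energy[OF that]
    by (simp add: has_bochner_integral_iff)
  \<comment> \<open>Starting frequencies: the factor \<open>exp (t / 4)\<close> makes the curve with
    \<open>n = 0\<close> arrive at \<open>\<xi>\<close> at time \<open>t\<close>.\<close>
  define a where "a n = exp (t / 4) * \<xi> / 2 ^ n" for n :: nat
  define c where "c n s = a n * exp (- s / 4)" for n s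
  have c_half: "c n s / 2 = c (Suc n) s" for n s by (simp add: c_def a_def)
  define \<psi> where "\<psi> s \<xi> = ?F s \<xi> - complex_of_real (H_hat \<xi>)" for s \<xi>
  define v where "v n s = exp s *\<^sub>R \<psi> s (c n s)" for n s
  define v' where "v' n s = exp s *\<^sub>R (\<psi> s (c (Suc n) s) * (?F s (c (Suc n) s) + complex_of_real (H_hat (c (Suc n) s))))" for n s
  have deriv: "(v n has_vector_derivative v' n s) (at s within {0..})" if s: "0 \<le> s" for n s
  proof -
    have c': "(c n has_real_derivative - c n s / 4) (at s within {0..})"
      unfolding c_def[abs_def] by (auto intro!: derivative_eq_intros)
    have F': "((\<lambda>s. ?F s (c n s)) has_vector_derivative
        ((c n s / 4) *\<^sub>R ?D s (c n s) + ((?F s (c n s / 2))\<^sup>2 - ?F s (c n s))) + (- c n s / 4) *\<^sub>R ?D s (c n s)) (at s within {0..})"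
      by (rule has_vector_derivative_along_curve[where D = ?D, OF taylor
          weak_solution_fourier[OF meas nonneg sol mass momentum s] c' s])
    have u': "((\<lambda>s. complex_of_real (H_hat (c n s))) has_vector_derivative
        complex_of_real ((H_hat (c n s / 2))\<^sup>2 - H_hat (c n s))) (at s within {0..})"
      unfolding c_def by (rule has_vector_derivative_of_real[OF H_hat_curve_derivative])
    have e': "(exp has_real_derivative exp s) (at s within {0..})"
      by (auto intro!: derivative_eq_intros)
    have "(v n has_vector_derivative
        exp s *\<^sub>R (((c n s / 4) *\<^sub>R ?D s (c n s) + ((?F s (c n s / 2))\<^sup>2 - ?F s (c n s))) + (- c n s / 4) *\<^sub>R ?D s (c n s)
          - complex_of_real ((H_hat (c n s / 2))\<^sup>2 - H_hat (c n s))) + exp s *\<^sub>R \<psi> s (c n s)) (at s within {0..})"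
      unfolding v_def[abs_def] \<psi>_def
      by (rule has_vector_derivative_scaleR[OF e' has_vector_derivative_diff[OF F' u']])
    also have "exp s *\<^sub>R (((c n s / 4) *\<^sub>R ?D s (c n s) + ((?F s (c n s / 2))\<^sup>2 - ?F s (c n s))) + (- c n s / 4) *\<^sub>R ?D s (c n s)
          - complex_of_real ((H_hat (c n s / 2))\<^sup>2 - H_hat (c n s))) + exp s *\<^sub>R \<psi> s (c n s) = v' n s"
    proof -
      \<comment> \<open>The transport terms cancel, and the loss terms cancel against the derivative
        of the weight \<open>exp s\<close>. What remains is a difference of squares at the halved
        frequency.\<close>
      have "(q *\<^sub>R d + (f2\<^sup>2 - f)) + (- q) *\<^sub>R d - complex_of_real (u2\<^sup>2 - u) + (f - complex_of_real u)
          = (f2 - complex_of_real u2) * (f2 + complex_of_real u2)" for q u u2 and d f f2 :: complex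
        by (simp add: power2_eq_square algebra_simps)
      then show ?thesis
        unfolding v'_def \<psi>_def c_half minus_divide_left[symmetric] scaleR_add_right[symmetric] by (rule arg_cong)
    qed
    finally show ?thesis .
  qed
  have v'_le: "norm (v' n s) \<le> 2 * norm (v (Suc n) s)" if "0 \<le> s" for n s
  proof -
    have "cmod (?F s (c (Suc n) s) + complex_of_real (H_hat (c (Suc n) s))) \<le> 1 + 1"
      by (rule order_trans[OF norm_triangle_ineq add_mono[OF F_le[OF that] u_le]])
    then have "cmod (\<psi> s (c (Suc n) s)) * cmod (?F s (c (Suc n) s) + complex_of_real (H_hat (c (Suc n) s))) \<le> cmod (\<psi> s (c (Suc n) s)) * 2"
      by (intro mult_left_mono) auto
    then show ?thesis by (simp add: v'_def v_def norm_mult)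
  qed
  \<comment> \<open>Unit mass bounds both transforms by 1. The resulting bound is the same for all
    \<open>n\<close>, so the truncation error tends to 0 with growing \<open>m\<close>.\<close>
  have K: "norm (v n s) \<le> 2 * exp t" if "0 \<le> s" "s \<le> t" for n s
  proof -
    have "cmod (\<psi> s (c n s)) \<le> 1 + 1"
      unfolding \<psi>_def by (rule order_trans[OF norm_triangle_ineq4 add_mono[OF F_le[OF that(1)] u_le]])
    then have "exp s * cmod (\<psi> s (c n s)) \<le> exp t * 2"
      using that by (intro mult_mono) auto
    then show ?thesis by (simp add: v_def)
  qed
  have "norm (v 0 t) \<le> (\<Sum>j<m. (2 * t) ^ j / fact j * norm (v (0 + j) 0)) + 2 * exp t * ((2 * t) ^ m / fact m)"
    by (rule iterated_growth_bound[where v = v and v' = v' and c = 2 and T = t and K = "2 * exp t", OF deriv v'_le K _ t order_refl]) simp_all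
  moreover have "norm (v 0 t) = exp t * cmod (\<psi> t \<xi>)"
  proof -
    have "c 0 t = \<xi>" by (simp add: c_def a_def exp_minus)
    then show ?thesis by (simp add: v_def)
  qed
  ultimately have scaled: "exp t * cmod (\<psi> t \<xi>) \<le>
      (\<Sum>j<m. (2 * t) ^ j / fact j * norm (v (0 + j) 0)) + 2 * exp t * ((2 * t) ^ m / fact m)"
    by (simp only:)
  \<comment> \<open>Multiplication by \<open>exp (- t)\<close> removes the weight on the left and at
    the same time the factor \<open>exp t\<close> in the bound \<open>K\<close>.\<close>
  have unscale: "x \<le> exp (- t) * A + 2 * R" if "exp t * x \<le> A + 2 * exp t * R" for x A R :: real
    using mult_left_mono[OF that, of "exp (- t)"] by (simp add: exp_minus field_simps)
  have "cmod (\<psi> t \<xi>) \<le> (\<Sum>j<m. exp (- t) * ((2 * t) ^ j / fact j * norm (v (0 + j) 0))) + 2 * ((2 * t) ^ m / fact m)"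
    unfolding sum_distrib_left[symmetric] by (rule unscale[OF scaled])
  also have "(\<Sum>j<m. exp (- t) * ((2 * t) ^ j / fact j * norm (v (0 + j) 0)))
      = (\<Sum>j<m. exp (- t) * (2 * t) ^ j / fact j * cmod (\<psi> 0 (exp (t / 4) / 2 ^ j * \<xi>)))"
  proof (rule sum.cong[OF refl])
    fix j
    have "norm (v (0 + j) 0) = cmod (\<psi> 0 (exp (t / 4) / 2 ^ j * \<xi>))"
      by (simp add: v_def c_def a_def)
    then show "exp (- t) * ((2 * t) ^ j / fact j * norm (v (0 + j) 0))
        = exp (- t) * (2 * t) ^ j / fact j * cmod (\<psi> 0 (exp (t / 4) / 2 ^ j * \<xi>))"
      by simp
  qed
  finally show ?thesis
    unfolding \<psi>_def fourier_H .
qed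

subsection \<open>Norm estimates for the majorant\<close>

text \<open>Jensen's inequality for the weights \<open>a n / s\<close>, where \<open>s\<close> is
  their total over the indices with positive \<open>y n\<close>. Undoing the normalisation costs
  \<open>s powr p / s\<close>, which is at most \<open>S powr (p - 1)\<close> since \<open>p\<close>
  is at least 1.\<close>

lemma sum_powr_le:
  fixes a y :: "'i \<Rightarrow> real"
  assumes fin: "finite A" and p: "1 \<le> p"
    and a: "\<And>n. n \<in> A \<Longrightarrow> 0 \<le> a n" and y: "\<And>n. n \<in> A \<Longrightarrow> 0 \<le> y n" and S: "sum a A \<le> S"
  shows "(\<Sum>n\<in>A. a n * y n) powr p \<le> S powr (p - 1) * (\<Sum>n\<in>A. a n * y n powr p)"
proof -
  \<comment> \<open>Dropping the terms with \<open>y n = 0\<close> changes neither sum and leaves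
    positive points for the convexity of the power.\<close>
  define B where "B = {n\<in>A. 0 < y n}"
  define s where "s = sum a B"
  have B: "finite B" "B \<subseteq> A" using fin by (auto simp: B_def)
  have aB: "0 \<le> a n" "0 < y n" if "n \<in> B" for n using that a by (auto simp: B_def)
  have drop: "(\<Sum>n\<in>A. a n * y n) = (\<Sum>n\<in>B. a n * y n)"
    using fin B y by (intro sum.mono_neutral_right) (force simp: B_def)+
  have drop': "(\<Sum>n\<in>A. a n * y n powr p) = (\<Sum>n\<in>B. a n * y n powr p)"
    using fin B y by (intro sum.mono_neutral_right) (force simp: B_def)+
  have s: "0 \<le> s" unfolding s_def by (intro sum_nonneg aB)
  have sS: "s \<le> S"
    unfolding s_def by (rule order_trans[OF sum_mono2 S]) (use fin B a in auto)
  show ?thesis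
  proof (cases "s = 0")
    case True
    then have "a n = 0" if "n \<in> B" for n
      using that B aB by (auto simp: s_def sum_nonneg_eq_0_iff)
    then show ?thesis using drop drop' by simp
  next
    case False
    then have s0: "0 < s" using s by simp
    then have "B \<noteq> {}" by (auto simp: s_def)
    then have "(\<Sum>n\<in>B. (a n / s) *\<^sub>R y n) powr p \<le> (\<Sum>n\<in>B. a n / s * y n powr p)"
      using B aB s0 p
      by (intro convex_on_sum[OF B(1) _ powr_convex])
        (auto simp: sum_divide_distrib[symmetric] s_def[symmetric])
    then have "s powr p * (\<Sum>n\<in>B. (a n / s) *\<^sub>R y n) powr p \<le> s powr p * (\<Sum>n\<in>B. a n / s * y n powr p)"
      by (intro mult_left_mono) auto
    also have "s powr p * (\<Sum>n\<in>B. (a n / s) *\<^sub>R y n) powr p = (s * (\<Sum>n\<in>B. (a n / s) *\<^sub>R y n)) powr p"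
      using s0 aB by (subst powr_mult) (auto intro!: sum_nonneg mult_nonneg_nonneg less_imp_le)
    also have "s * (\<Sum>n\<in>B. (a n / s) *\<^sub>R y n) = (\<Sum>n\<in>B. a n * y n)"
      using s0 by (simp add: sum_distrib_left)
    also have "s powr p * (\<Sum>n\<in>B. a n / s * y n powr p) = s powr (p - 1) * (\<Sum>n\<in>B. a n * y n powr p)"
      using s0 by (simp add: sum_distrib_left powr_diff)
    also have "\<dots> \<le> S powr (p - 1) * (\<Sum>n\<in>B. a n * y n powr p)"
      using s0 sS p aB by (intro mult_right_mono powr_mono2 sum_nonneg) auto
    finally show ?thesis using drop drop' by simp
  qed
qed

text \<open>\<open>rate\<close> vanishes at 2 and 3 and has a strictly decreasing derivative. A
  nonpositive value at \<open>k\<close> would force a nonpositive slope at some point before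
  \<open>k\<close> and a nonnegative one at some point after it.\<close>

lemma rate_pos:
  assumes "2 < k" "k < 3"
  shows "0 < rate k"
proof -
  let ?f' = "\<lambda>k::real. - 1 / 4 + ln 2 * 2 powr (1 - k)"
  have deriv: "(rate has_real_derivative ?f' x) (at x)" for x
    unfolding rate_def[abs_def] by (auto intro!: derivative_eq_intros)
  have z: "rate 2 = 0" "rate 3 = 0" by (auto simp: rate_def powr_minus_divide)
  obtain u where u: "2 < u" "u < k" "rate k - rate 2 = (k - 2) * ?f' u"
    using MVT2[OF assms(1), of rate ?f'] deriv by blast
  obtain v where v: "k < v" "v < 3" "rate 3 - rate k = (3 - k) * ?f' v"
    using MVT2[OF assms(2), of rate ?f'] deriv by blast
  have lt: "?f' v < ?f' u" using u v by simp
  show ?thesis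
  proof (rule ccontr)
    assume "\<not> ?thesis"
    then have "(k - 2) * ?f' u \<le> 0" "0 \<le> (3 - k) * ?f' v" using u v z by auto
    then show False using assms lt by (simp add: mult_le_0_iff zero_le_mult_iff)
  qed
qed

lemma sum_power_fact_le_exp:
  fixes x :: real
  assumes "0 \<le> x"
  shows "(\<Sum>j<m. x ^ j / fact j) \<le> exp x"
proof -
  have "(\<lambda>j. x ^ j / fact j) sums exp x"
    using exp_converges[of x] by (simp add: divide_inverse_commute)
  then show ?thesis
    using sum_le_suminf[of "\<lambda>j. x ^ j / fact j" "{..<m}"] assms by (simp add: sums_iff)
qed

text \<open>The origin of the rate: a dilation by \<open>exp (t / 4) / 2 ^ j\<close> multiplies a
  norm of homogeneity \<open>\<kappa>\<close> by the power shown. Each halving then divides the term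
  by \<open>2 powr \<kappa>\<close>, so these are terms of the exponential series at
  \<open>2 powr (1 - \<kappa>) * t\<close>, and the exponents collect to
  \<open>- rate \<kappa> * t\<close>.\<close>

lemma weight_sum_le:
  assumes t: "0 \<le> t"
  shows "(\<Sum>j<m. exp (- t) * (2 * t) ^ j / fact j * (exp (t / 4) / 2 ^ j) powr \<kappa>) \<le> exp (- rate \<kappa> * t)"
proof -
  have eq: "exp (- t) * (2 * t) ^ j / fact j * (exp (t / 4) / 2 ^ j) powr \<kappa>
      = exp (\<kappa> * t / 4 - t) * ((2 powr (1 - \<kappa>) * t) ^ j / fact j)" for j
  proof -
    have "((2::real) ^ j) powr \<kappa> = (2 powr \<kappa>) ^ j"
      by (simp add: powr_realpow[symmetric] powr_powr mult.commute)
    moreover have "exp (t / 4) powr \<kappa> = exp (\<kappa> * t / 4)"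
      by (simp add: powr_def)
    ultimately have l: "(exp (t / 4) / 2 ^ j) powr \<kappa> = exp (\<kappa> * t / 4) / (2 powr \<kappa>) ^ j"
      by (simp add: powr_divide)
    have "(2 powr (1 - \<kappa>) * t) ^ j = (2 * t) ^ j / (2 powr \<kappa>) ^ j"
      by (simp add: powr_diff power_mult_distrib power_divide)
    moreover have "exp (\<kappa> * t / 4 - t) = exp (- t) * exp (\<kappa> * t / 4)"
      by (simp add: exp_add[symmetric])
    ultimately show ?thesis unfolding l by (simp add: mult_ac)
  qed
  have "(\<Sum>j<m. exp (- t) * (2 * t) ^ j / fact j * (exp (t / 4) / 2 ^ j) powr \<kappa>)
      = exp (\<kappa> * t / 4 - t) * (\<Sum>j<m. (2 powr (1 - \<kappa>) * t) ^ j / fact j)"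
    unfolding eq by (rule sum_distrib_left[symmetric])
  also have "\<dots> \<le> exp (\<kappa> * t / 4 - t) * exp (2 powr (1 - \<kappa>) * t)"
    using t by (intro mult_left_mono sum_power_fact_le_exp) auto
  also have "\<dots> = exp (- rate \<kappa> * t)"
    by (simp add: rate_def exp_add[symmetric] algebra_simps)
  finally show ?thesis .
qed

text \<open>Under dilations the integral norm scales with exponent \<open>k - 1 / p\<close>, the
  Jacobian contributing \<open>1 / p\<close>; the supremum rate at that exponent is therefore the
  right one.\<close>

lemma rate_p_eq: "rate_p k p = rate (k - 1 / p)"
  by (simp add: rate_p_def rate_def field_simps)

lemma power_fact_tendsto_0: "(\<lambda>m. K * ((x::real) ^ m / fact m)) \<longlonglongrightarrow> 0"
proof (rule tendsto_mult_right_zero)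
  show "(\<lambda>m. x ^ m / fact m) \<longlonglongrightarrow> 0"
    using summable_LIMSEQ_zero[OF summable_exp[of x]] by (simp add: divide_inverse_commute)
qed

text \<open>The last summand is the error of truncating the iteration after \<open>m\<close> steps.\<close>
definition dominated_at :: "real \<Rightarrow> (real \<Rightarrow> complex) \<Rightarrow> (real \<Rightarrow> complex) \<Rightarrow> bool" where
  "dominated_at t \<psi>0 \<psi> \<longleftrightarrow> (\<forall>\<xi> m. cmod (\<psi> \<xi>) \<le>
     (\<Sum>j<m. exp (- t) * (2 * t) ^ j / fact j * cmod (\<psi>0 (exp (t / 4) / 2 ^ j * \<xi>))) + 2 * ((2 * t) ^ m / fact m))"

section \<open>Transfer of the majorant to the two Fourier norms\<close>

lemma abs_mult_powr:
  fixes l :: real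
  assumes "0 < l"
  shows "\<bar>l * \<xi>\<bar> powr k = l powr k * \<bar>\<xi>\<bar> powr k"
  using assms by (simp add: abs_mult powr_mult)

text \<open>A finite initial norm \<open>r\<close> means that the datum is at most
  \<open>r * \<bar>\<xi>\<bar> powr k\<close> away from 0. Each dilated term inherits this with its
  scaling factor, \<open>weight_sum_le\<close> sums the factors for every \<open>m\<close>, and the
  error vanishes as \<open>m\<close> grows. For an infinite initial norm the right-hand side is
  infinite.\<close>

lemma fnorm_dominated:
  assumes t: "0 \<le> t" and dom: "dominated_at t \<psi>0 \<psi>"
  shows "fnorm k \<psi> \<le> ennreal (exp (- rate k * t)) * fnorm k \<psi>0"
proof (cases "fnorm k \<psi>0")
  case (real r)
  have le: "cmod (\<psi>0 \<xi>) \<le> r * \<bar>\<xi>\<bar> powr k" if "\<xi> \<noteq> 0" for \<xi>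
  proof -
    have "ennreal (cmod (\<psi>0 \<xi>) / \<bar>\<xi>\<bar> powr k) \<le> fnorm k \<psi>0"
      unfolding fnorm_def using that by (intro SUP_upper) auto
    then have "cmod (\<psi>0 \<xi>) / \<bar>\<xi>\<bar> powr k \<le> r" using real by (simp add: ennreal_le_iff)
    then show ?thesis using that by (simp add: field_simps)
  qed
  have "cmod (\<psi> \<xi>) / \<bar>\<xi>\<bar> powr k \<le> exp (- rate k * t) * r" if \<xi>: "\<xi> \<noteq> 0" for \<xi>
  proof -
    have "cmod (\<psi> \<xi>) \<le> exp (- rate k * t) * (r * \<bar>\<xi>\<bar> powr k) + 2 * ((2 * t) ^ m / fact m)" for m
    proof -
      have "(\<Sum>j<m. exp (- t) * (2 * t) ^ j / fact j * cmod (\<psi>0 (exp (t / 4) / 2 ^ j * \<xi>)))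
          \<le> (\<Sum>j<m. exp (- t) * (2 * t) ^ j / fact j * (r * ((exp (t / 4) / 2 ^ j) powr k * \<bar>\<xi>\<bar> powr k)))"
      proof (intro sum_mono mult_left_mono)
        fix j
        show "cmod (\<psi>0 (exp (t / 4) / 2 ^ j * \<xi>)) \<le> r * ((exp (t / 4) / 2 ^ j) powr k * \<bar>\<xi>\<bar> powr k)"
          using le[of "exp (t / 4) / 2 ^ j * \<xi>"] \<xi> abs_mult_powr[of "exp (t / 4) / 2 ^ j" \<xi> k] by simp
      qed (use t in simp)
      also have "\<dots> = (\<Sum>j<m. exp (- t) * (2 * t) ^ j / fact j * (exp (t / 4) / 2 ^ j) powr k) * (r * \<bar>\<xi>\<bar> powr k)"
        unfolding sum_distrib_right by (intro sum.cong refl) (simp only: mult_ac)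
      also have "\<dots> \<le> exp (- rate k * t) * (r * \<bar>\<xi>\<bar> powr k)"
        using real(1) by (intro mult_right_mono weight_sum_le[OF t]) simp
      finally show ?thesis
        using dom[unfolded dominated_at_def, rule_format, of \<xi> m] by linarith
    qed
    moreover have "(\<lambda>m. exp (- rate k * t) * (r * \<bar>\<xi>\<bar> powr k) + 2 * ((2 * t) ^ m / fact m))
        \<longlonglongrightarrow> exp (- rate k * t) * (r * \<bar>\<xi>\<bar> powr k) + 0"
      by (intro tendsto_add tendsto_const power_fact_tendsto_0)
    ultimately have "cmod (\<psi> \<xi>) \<le> exp (- rate k * t) * (r * \<bar>\<xi>\<bar> powr k) + 0"
      by (intro LIMSEQ_le_const) auto
    then show ?thesis using \<xi> by (simp add: pos_divide_le_eq mult.assoc)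
  qed
  then have "fnorm k \<psi> \<le> ennreal (exp (- rate k * t) * r)"
    unfolding fnorm_def by (intro SUP_least ennreal_leI) auto
  then show ?thesis using real by (simp add: ennreal_mult)
next
  case top
  then show ?thesis by (simp add: ennreal_mult_top)
qed

text \<open>The estimate is made for the integrals of \<open>p\<close>-th powers with values in
  \<open>ennreal\<close>, so infinite values are covered. Jensen's inequality contributes
  \<open>S powr (p - 1)\<close> and the remaining sum of weights contributes \<open>S\<close>,
  together \<open>S powr p\<close>.\<close>

lemma nn_integral_dominated:
  assumes t: "0 \<le> t" and dom: "dominated_at t \<psi>0 \<psi>" and p: "1 \<le> p"
    and [measurable]: "\<psi>0 \<in> borel_measurable borel"
  shows "(\<integral>\<^sup>+\<xi>. ennreal (cmod (\<psi> \<xi>) powr p / \<bar>\<xi>\<bar> powr (k * p)) \<partial>lborel)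
    \<le> ennreal (exp (- rate_p k p * t) powr p) * (\<integral>\<^sup>+\<xi>. ennreal (cmod (\<psi>0 \<xi>) powr p / \<bar>\<xi>\<bar> powr (k * p)) \<partial>lborel)"
    (is "_ \<le> _ * ?I0")
proof -
  define \<kappa> where "\<kappa> = k - 1 / p"
  define S where "S = exp (- rate \<kappa> * t)"
  define l where "l j = exp (t / 4) / 2 ^ j" for j :: nat
  \<comment> \<open>The scaling factor of each dilation is moved from the function into the weight:
    after this normalisation all \<open>y j\<close> have the same weighted integral as the initial
    datum, and the weights sum to at most \<open>S\<close>.\<close>
  define a where "a j = exp (- t) * (2 * t) ^ j / fact j * l j powr \<kappa>" for j
  define y where "y j \<xi> = cmod (\<psi>0 (l j * \<xi>)) / l j powr \<kappa>" for j \<xi>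
  define f where "f \<xi> = cmod (\<psi>0 \<xi>) powr p / \<bar>\<xi>\<bar> powr (k * p)" for \<xi>
  have [measurable]: "f \<in> borel_measurable borel" "\<And>j. y j \<in> borel_measurable borel"
    unfolding f_def[abs_def] y_def[abs_def] by measurable
  have l: "0 < l j" for j by (simp add: l_def)
  have a: "0 \<le> a j" for j using t by (simp add: a_def)
  have y: "0 \<le> y j \<xi>" for j \<xi> by (simp add: y_def)
  have f: "0 \<le> f \<xi>" for \<xi> by (simp add: f_def)
  have S: "0 < S" by (simp add: S_def)
  have aS: "(\<Sum>j<m. a j) \<le> S" for m
    unfolding a_def l_def S_def by (rule weight_sum_le[OF t])
  have dom': "cmod (\<psi> \<xi>) \<le> (\<Sum>j<m. a j * y j \<xi>) + 2 * ((2 * t) ^ m / fact m)" for \<xi> m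
  proof -
    have "a j * y j \<xi> = exp (- t) * (2 * t) ^ j / fact j * cmod (\<psi>0 (exp (t / 4) / 2 ^ j * \<xi>))" for j
      using l[of j] by (simp add: a_def y_def) (simp add: l_def)
    then show ?thesis using dom by (simp add: dominated_at_def)
  qed
  \<comment> \<open>The choice \<open>\<kappa> = k - 1 / p\<close> leaves exactly the Jacobian
    \<open>l j\<close>. At \<open>\<xi> = 0\<close> both sides are 0, since
    \<open>0 powr (k * p)\<close> is 0 and so is division by it.\<close>
  have scaled: "y j \<xi> powr p / \<bar>\<xi>\<bar> powr (k * p) = l j * f (l j * \<xi>)" for j \<xi>
  proof -
    have "(l j powr \<kappa>) powr p = l j powr (k * p - 1)"
      using p by (simp add: powr_powr \<kappa>_def left_diff_distrib)
    also have "\<dots> = l j powr (k * p) / l j"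
      using l[of j] by (simp add: powr_diff)
    finally have "(l j powr \<kappa>) powr p = l j powr (k * p) / l j" .
    then show ?thesis
      using l[of j] by (simp add: y_def f_def powr_divide abs_mult_powr)
  qed
  have term_int: "(\<integral>\<^sup>+\<xi>. ennreal (y j \<xi> powr p / \<bar>\<xi>\<bar> powr (k * p)) \<partial>lborel) = ?I0" for j
  proof -
    have "?I0 = ennreal (l j) * (\<integral>\<^sup>+\<xi>. ennreal (f (0 + l j * \<xi>)) \<partial>lborel)"
      unfolding f_def[symmetric] using l[of j] by (subst nn_integral_real_affine[of _ "l j" 0]) auto
    also have "\<dots> = (\<integral>\<^sup>+\<xi>. ennreal (l j * f (l j * \<xi>)) \<partial>lborel)"
      using l[of j] f by (subst nn_integral_cmult[symmetric]) (auto simp: ennreal_mult less_imp_le)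
    finally show ?thesis by (simp add: scaled)
  qed
  let ?R = "\<lambda>\<xi>. ennreal (S powr (p - 1)) * (\<Sum>j. ennreal (a j) * ennreal (y j \<xi> powr p / \<bar>\<xi>\<bar> powr (k * p)))"
  have pointwise: "ennreal (cmod (\<psi> \<xi>) powr p / \<bar>\<xi>\<bar> powr (k * p)) \<le> ?R \<xi>" for \<xi>
  proof (rule LIMSEQ_le_const2)
    \<comment> \<open>The truncation error is subtracted on the left before the power is taken, so
      that Jensen's inequality meets a pure weighted sum; continuity of the power then gives the
      limit in \<open>m\<close>. The maximum with 0 keeps the base nonnegative, where the power is
      monotone.\<close>
    let ?d = "\<lambda>m. max 0 (cmod (\<psi> \<xi>) - 2 * ((2 * t) ^ m / fact m))"
    have "?d \<longlonglongrightarrow> max 0 (cmod (\<psi> \<xi>) - 0)"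
      by (intro tendsto_max tendsto_diff tendsto_const power_fact_tendsto_0)
    then have "?d \<longlonglongrightarrow> cmod (\<psi> \<xi>)" by simp
    then have "(\<lambda>m. ?d m powr p / \<bar>\<xi>\<bar> powr (k * p)) \<longlonglongrightarrow> cmod (\<psi> \<xi>) powr p / \<bar>\<xi>\<bar> powr (k * p)"
      unfolding divide_inverse using p by (intro tendsto_mult tendsto_const tendsto_powr') auto
    then show "(\<lambda>m. ennreal (?d m powr p / \<bar>\<xi>\<bar> powr (k * p))) \<longlonglongrightarrow> ennreal (cmod (\<psi> \<xi>) powr p / \<bar>\<xi>\<bar> powr (k * p))"
      by (rule tendsto_ennrealI)
    show "\<exists>N. \<forall>m\<ge>N. ennreal (?d m powr p / \<bar>\<xi>\<bar> powr (k * p)) \<le> ?R \<xi>"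
    proof (intro exI allI impI)
      fix m :: nat
      have "?d m \<le> (\<Sum>j<m. a j * y j \<xi>)"
        using dom'[of \<xi> m] a y by (auto intro!: sum_nonneg)
      then have "?d m powr p \<le> (\<Sum>j<m. a j * y j \<xi>) powr p"
        using p by (intro powr_mono2) auto
      also have "\<dots> \<le> S powr (p - 1) * (\<Sum>j<m. a j * y j \<xi> powr p)"
        using p a y aS by (intro sum_powr_le) auto
      finally have "?d m powr p / \<bar>\<xi>\<bar> powr (k * p) \<le> S powr (p - 1) * (\<Sum>j<m. a j * y j \<xi> powr p) / \<bar>\<xi>\<bar> powr (k * p)"
        by (rule divide_right_mono) simp
      also have "\<dots> = S powr (p - 1) * (\<Sum>j<m. a j * (y j \<xi> powr p / \<bar>\<xi>\<bar> powr (k * p)))"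
        by (simp only: times_divide_eq_right sum_divide_distrib[symmetric])
      finally have "ennreal (?d m powr p / \<bar>\<xi>\<bar> powr (k * p)) \<le> ennreal (S powr (p - 1) * (\<Sum>j<m. a j * (y j \<xi> powr p / \<bar>\<xi>\<bar> powr (k * p))))"
        by (rule ennreal_leI)
      also have "\<dots> = ennreal (S powr (p - 1)) * (\<Sum>j<m. ennreal (a j) * ennreal (y j \<xi> powr p / \<bar>\<xi>\<bar> powr (k * p)))"
      proof -
        have "(\<Sum>j<m. ennreal (a j) * ennreal (y j \<xi> powr p / \<bar>\<xi>\<bar> powr (k * p)))
            = ennreal (\<Sum>j<m. a j * (y j \<xi> powr p / \<bar>\<xi>\<bar> powr (k * p)))"
          using a by (subst sum_ennreal[symmetric]) (auto simp: ennreal_mult simp del: times_divide_eq_right)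
        then show ?thesis by (simp only: ennreal_mult' powr_ge_zero)
      qed
      also have "\<dots> \<le> ?R \<xi>"
        by (intro mult_left_mono sum_le_suminf) auto
      finally show "ennreal (?d m powr p / \<bar>\<xi>\<bar> powr (k * p)) \<le> ?R \<xi>" .
    qed
  qed
  have "(\<integral>\<^sup>+\<xi>. ennreal (cmod (\<psi> \<xi>) powr p / \<bar>\<xi>\<bar> powr (k * p)) \<partial>lborel) \<le> (\<integral>\<^sup>+\<xi>. ?R \<xi> \<partial>lborel)"
    by (intro nn_integral_mono pointwise)
  \<comment> \<open>Monotone convergence exchanges sum and integral, and every term contributes the
    same integral \<open>?I0\<close>.\<close>
  also have "\<dots> = ennreal (S powr (p - 1)) * (\<Sum>j. ennreal (a j) * ?I0)"
    by (simp add: nn_integral_cmult nn_integral_suminf term_int)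
  also have "(\<Sum>j. ennreal (a j) * ?I0) = (\<Sum>j. ennreal (a j)) * ?I0"
    by (rule ennreal_suminf_multc)
  also have "(\<Sum>j. ennreal (a j)) \<le> ennreal S"
    using a aS by (intro suminf_le_const) (auto simp: sum_ennreal intro: ennreal_leI)
  then have "ennreal (S powr (p - 1)) * ((\<Sum>j. ennreal (a j)) * ?I0) \<le> ennreal (S powr (p - 1)) * (ennreal S * ?I0)"
    by (intro mult_left_mono mult_right_mono) auto
  also have "\<dots> = ennreal (S powr p) * ?I0"
    using S by (simp add: powr_diff mult.assoc[symmetric] flip: ennreal_mult)
  finally show ?thesis by (simp add: S_def \<kappa>_def rate_p_eq)
qed

text \<open>The \<open>p\<close>-th root of the preceding estimate. An infinite initial integral
  makes the right-hand side infinite; a finite one forces finiteness on the left, so that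
  \<open>ennpowr\<close> is there an ordinary real power.\<close>

lemma fnorm_p_dominated:
  assumes t: "0 \<le> t" and dom: "dominated_at t \<psi>0 \<psi>" and p: "1 \<le> p"
    and meas: "\<psi>0 \<in> borel_measurable borel"
  shows "fnorm_p k p \<psi> \<le> ennreal (exp (- rate_p k p * t)) * fnorm_p k p \<psi>0"
proof -
  let ?I = "\<lambda>\<psi>. \<integral>\<^sup>+\<xi>. ennreal (cmod (\<psi> \<xi>) powr p / \<bar>\<xi>\<bar> powr (k * p)) \<partial>lborel"
  let ?S = "exp (- rate_p k p * t)"
  note le = nn_integral_dominated[OF t dom p meas, of k]
  show ?thesis
  proof (cases "?I \<psi>0")
    case top
    then show ?thesis by (simp add: fnorm_p_def ennpowr_def ennreal_mult_top)
  next
    case (real r)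
    have le': "?I \<psi> \<le> ennreal (?S powr p * r)"
      using le real by (simp add: ennreal_mult)
    then have fin: "?I \<psi> \<noteq> \<infinity>" using ennreal_less_top order_le_less_trans by (metis infinity_ennreal_def less_irrefl)
    have "enn2real (?I \<psi>) \<le> ?S powr p * r"
      using le' real(1) by (intro enn2real_leI) auto
    then have "enn2real (?I \<psi>) powr (1 / p) \<le> (?S powr p * r) powr (1 / p)"
      using p by (intro powr_mono2) auto
    also have "\<dots> = ?S * r powr (1 / p)"
      using p real(1) by (simp add: powr_mult powr_powr)
    finally have "ennreal (enn2real (?I \<psi>) powr (1 / p)) \<le> ennreal (?S * r powr (1 / p))"
      by (rule ennreal_leI)
    then show ?thesis
      using fin real by (simp add: fnorm_p_def ennpowr_def ennreal_mult)
  qed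
qed

lemma decays_exponentiallyI:
  assumes r: "0 < r" and N: "\<And>t. 0 \<le> t \<Longrightarrow> N t \<le> ennreal (exp (- r * t)) * N0" and fin: "N0 < \<infinity>"
  shows "decays_exponentially N"
proof -
  obtain C where C: "0 \<le> C" "N0 = ennreal C" using fin by (cases N0) auto
  have "N t \<le> ennreal (C * exp (- r * t))" if "0 \<le> t" for t
    using N[OF that] C by (simp add: ennreal_mult mult.commute)
  then show ?thesis using r unfolding decays_exponentially_def by blast
qed

subsection \<open>Convergence to the steady solution\<close>

theorem theorem1p3:
  fixes g :: "real \<Rightarrow> real \<Rightarrow> real" and g0 :: "real \<Rightarrow> real"
  assumes meas: "\<And>t. 0 \<le> t \<Longrightarrow> g t \<in> borel_measurable borel"
    and nonneg: "\<And>t x. 0 \<le> t \<Longrightarrow> 0 \<le> g t x"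
    and sol: "weak_solution (\<lambda>t. density lborel (\<lambda>x. ennreal (g t x)))"
    and init: "g 0 = g0"
    and mass: "\<And>t. 0 \<le> t \<Longrightarrow> has_bochner_integral lborel (\<lambda>x. g t x) 1"
    and momentum: "\<And>t. 0 \<le> t \<Longrightarrow> has_bochner_integral lborel (\<lambda>x. x * g t x) 0"
    and energy: "\<And>t. 0 \<le> t \<Longrightarrow> has_bochner_integral lborel (\<lambda>x. x\<^sup>2 * g t x) 1"
  shows
    "(\<forall>k. 0 \<le> k \<and> k < 3 \<longrightarrow> (\<forall>t\<ge>0.
        fnorm k (\<lambda>\<xi>. fourier (g t) \<xi> - fourier H \<xi>)
          \<le> ennreal (exp (- rate k * t)) * fnorm k (\<lambda>\<xi>. fourier g0 \<xi> - fourier H \<xi>))) \<and>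
     (\<forall>k. 2 < k \<and> k < 3 \<longrightarrow>
        0 < rate k \<and>
        (fnorm k (\<lambda>\<xi>. fourier g0 \<xi> - fourier H \<xi>) < \<infinity> \<longrightarrow>
          decays_exponentially (\<lambda>t. fnorm k (\<lambda>\<xi>. fourier (g t) \<xi> - fourier H \<xi>)))) \<and>
     (\<forall>p k. 1 \<le> p \<and> 1 / p < k \<and> k < 3 + 1 / p \<longrightarrow> (\<forall>t\<ge>0.
        fnorm_p k p (\<lambda>\<xi>. fourier (g t) \<xi> - fourier H \<xi>)
          \<le> ennreal (exp (- rate_p k p * t)) * fnorm_p k p (\<lambda>\<xi>. fourier g0 \<xi> - fourier H \<xi>))) \<and>
     (\<forall>p k. 1 \<le> p \<and> 0 < rate_p k p \<longrightarrow>
        fnorm_p k p (\<lambda>\<xi>. fourier g0 \<xi> - fourier H \<xi>) < \<infinity> \<longrightarrow>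
          decays_exponentially (\<lambda>t. fnorm_p k p (\<lambda>\<xi>. fourier (g t) \<xi> - fourier H \<xi>)))"
proof -
  let ?\<psi> = "\<lambda>t \<xi>. fourier (g t) \<xi> - fourier H \<xi>"
  have dom: "dominated_at t (?\<psi> 0) (?\<psi> t)" if "0 \<le> t" for t
    unfolding dominated_at_def
    by (intro allI dominated_by_initial[OF meas nonneg sol mass integrable.intros[OF momentum] energy that])
  have [measurable]: "g 0 \<in> borel_measurable borel" "H \<in> borel_measurable borel"
    using meas[of 0] integrable_H by auto
  \<comment> \<open>Measurability of the initial difference is what allows its dilations to be
    integrated and summed in the integral norm.\<close>
  have meas0: "?\<psi> 0 \<in> borel_measurable borel" by measurable
  have sup: "fnorm k (?\<psi> t) \<le> ennreal (exp (- rate k * t)) * fnorm k (?\<psi> 0)" if "0 \<le> t" for k t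
    using that by (intro fnorm_dominated dom)
  have Lp: "fnorm_p k p (?\<psi> t) \<le> ennreal (exp (- rate_p k p * t)) * fnorm_p k p (?\<psi> 0)"
    if "0 \<le> t" "1 \<le> p" for k p t
    using that by (intro fnorm_p_dominated dom meas0)
  show ?thesis
    unfolding init[symmetric]
  proof (intro conjI allI impI)
    show "fnorm k (?\<psi> t) \<le> ennreal (exp (- rate k * t)) * fnorm k (?\<psi> 0)" if "0 \<le> t" for k t
      by (rule sup[OF that])
    show "0 < rate k" if "2 < k \<and> k < 3" for k
      using that by (simp add: rate_pos)
    \<comment> \<open>Positivity of the rate gives the exponent, and finiteness of the initial norm
      gives the real constant.\<close>
    show "decays_exponentially (\<lambda>t. fnorm k (?\<psi> t))" if "2 < k \<and> k < 3" "fnorm k (?\<psi> 0) < \<infinity>" for k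
      using that by (intro decays_exponentiallyI[OF rate_pos sup]) auto
    show "fnorm_p k p (?\<psi> t) \<le> ennreal (exp (- rate_p k p * t)) * fnorm_p k p (?\<psi> 0)"
      if "1 \<le> p \<and> 1 / p < k \<and> k < 3 + 1 / p" "0 \<le> t" for p k t
      using that by (intro Lp) auto
    show "decays_exponentially (\<lambda>t. fnorm_p k p (?\<psi> t))"
      if "1 \<le> p \<and> 0 < rate_p k p" "fnorm_p k p (?\<psi> 0) < \<infinity>" for p k
      using that by (intro decays_exponentiallyI[OF _ Lp]) auto
  qed
qed

end
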